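(* Let $\alpha \geq -1$ be real and let $p$ be a real number with $2(k - 1) < p \leq 2k$ for some integer $k \geq 2$. Then, for every $f \in A^2_\alpha$, $$\| f \|_{A^p_{\frac{p}{2}(\alpha + 2) - 2}} \leq \left( \frac{p}{2} \right)^{\frac{1}{p}} \frac{1}{(k-1)^{\frac{k}{p}-\frac{1}{2}}\,k^{\frac{1}{2}-\frac{k-1}{p}}} \, \| f \|_{A^2_\alpha}.$$
   Context: Let $\mathbb{D}$ be the open unit disk of $\mathbb{C}$, and let $dA(z) = \frac{1}{\pi}\,dx\,dy$ be the normalized area measure on $\mathbb{D}$. For $q>0$ and $\beta>-1$, the standard weighted Bergman space $A^q_\beta$ is the set of all holomorphic functions $f$ on $\mathbb{D}$ such that $$\|f\|_{A^q_\beta} := \left( (\beta+1)\int_{\mathbb{D}} (1-|z|^2)^\beta |f(z)|^q \, dA(z)\right)^{1/q} < \infty.$$ For $\beta=-1$, by convention $A^q_{-1}$ is the Hardy space $H^q$ of holomorphic $f$ on $\mathbb{D}$ with $$\|f\|_{A^q_{-1}} := \|f\|_{H^q} := \sup_{0<r<1}\left(\frac{1}{2\pi}\int_0^{2\pi}|f(re^{it})|^q\,dt\right)^{1/q}<\infty.$$ Note that $\frac{p}{2}(\alpha+2)-2>-1$ when $p>2$ and $\alpha\ge -1$. *)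

theory Defs
  imports "HOL-Complex_Analysis.Complex_Analysis"
begin

text \<open>
  The factor \<open>1 / pi\<close> normalises the area measure of the unit disc.  Only the values of \<open>f\<close> on
  the open unit disc matter.  The norms are real-valued, so finiteness is expressed by the
  membership predicates (integrability, respectively boundedness of the integral means).
\<close>

definition bergman_space :: "real \<Rightarrow> real \<Rightarrow> (complex \<Rightarrow> complex) set" where
  "bergman_space q \<beta> =
     {f. f holomorphic_on ball 0 1 \<and>
         set_integrable lborel (ball 0 1) (\<lambda>z. (1 - (cmod z)\<^sup>2) powr \<beta> * cmod (f z) powr q)}"

definition bergman_norm :: "real \<Rightarrow> real \<Rightarrow> (complex \<Rightarrow> complex) \<Rightarrow> real" where
  "bergman_norm q \<beta> f =
     ((\<beta> + 1) * (1 / pi *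
        (LINT z:ball 0 1|lborel. (1 - (cmod z)\<^sup>2) powr \<beta> * cmod (f z) powr q))) powr (1 / q)"

definition hardy_mean :: "real \<Rightarrow> (complex \<Rightarrow> complex) \<Rightarrow> real \<Rightarrow> real" where
  "hardy_mean q f r =
     (1 / (2 * pi) * integral {0..2 * pi} (\<lambda>t. cmod (f (of_real r * cis t)) powr q)) powr (1 / q)"

definition hardy_space :: "real \<Rightarrow> (complex \<Rightarrow> complex) set" where
  "hardy_space q =
     {f. f holomorphic_on ball 0 1 \<and> bdd_above (hardy_mean q f ` {0<..<1})}"

definition hardy_norm :: "real \<Rightarrow> (complex \<Rightarrow> complex) \<Rightarrow> real" where
  "hardy_norm q f = (SUP r\<in>{0<..<1}. hardy_mean q f r)"

text \<open>The scale \<open>A\<^sup>q\<^sub>\<beta>\<close>, meant for \<open>q > 0\<close> and \<open>\<beta> \<ge> -1\<close>, with the convention \<open>A\<^sup>q\<^sub>-\<^sub>1 = H\<^sup>q\<close>.\<close>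

definition A_space :: "real \<Rightarrow> real \<Rightarrow> (complex \<Rightarrow> complex) set" where
  "A_space q \<beta> = (if \<beta> = -1 then hardy_space q else bergman_space q \<beta>)"

definition A_norm :: "real \<Rightarrow> real \<Rightarrow> (complex \<Rightarrow> complex) \<Rightarrow> real" where
  "A_norm q \<beta> f = (if \<beta> = -1 then hardy_norm q f else bergman_norm q \<beta> f)"

end

theory Submission
  imports Defs
begin

text \<open>
  Put \<open>s = \<alpha> + 2 \<ge> 1\<close>, \<open>x = p / 2\<close> and \<open>t = \<bar>z\<bar>\<^sup>2\<close>, and let \<open>w\<^sub>n(\<sigma>)\<close> be the reciprocal of the \<open>n\<close>-th
  coefficient of \<open>(1 - X)\<^sup>-\<^sup>\<sigma>\<close>.  The squared norm of \<open>f\<close> in the Hilbert space \<open>A\<^sup>2\<^sub>\<alpha>\<close> is the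
  coefficient sum \<open>\<Sum> w\<^sub>n(s) \<bar>a\<^sub>n\<bar>\<^sup>2\<close>, for the Hardy space (\<open>s = 1\<close>) as well as for the Bergman spaces.

  When \<open>p = 2 j\<close> is an even integer, the \<open>p\<close>-th power of the left hand norm is the squared norm of
  \<open>f\<^sup>j\<close> in \<open>A\<^sup>2\<close> with parameter \<open>j s - 2\<close>.  Because \<open>(1 - X)\<^sup>-\<^sup>\<sigma> (1 - X)\<^sup>-\<^sup>\<tau> = (1 - X)\<^sup>-\<^sup>(\<^sup>\<sigma>\<^sup>+\<^sup>\<tau>\<^sup>)\<close>, the Cauchy-Schwarz
  inequality for the convolutions that form the coefficients of a product shows that this is at most
  \<open>\<parallel>f\<parallel>\<^sup>2\<^sup>j\<close> (\<open>coeff_energy_mult_le\<close>, \<open>coeff_energy_power_le\<close>).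

  For \<open>k - 1 < x \<le> k\<close> one interpolates between \<open>j = k - 1\<close> and \<open>j = k\<close>.  Doing so directly with the
  integrals of \<open>(1 - t)\<^sup>x\<^sup>s\<^sup>-\<^sup>2 \<bar>f\<bar>\<^sup>2\<^sup>x\<close> gives too large a constant, because of the normalising factor
  \<open>x s - 1\<close>, and nothing at all when \<open>(k - 1) s = 1\<close>, where that integral diverges.  Green's formula
  repairs this.  With \<open>D\<^sub>\<beta>(h)\<close> the integral of \<open>(1 - t)\<^sup>\<beta> h\<close> for the normalised area measure,
  \<open>(x s - 1) D\<^sub>x\<^sub>s\<^sub>-\<^sub>2(\<bar>f\<bar>\<^sup>2\<^sup>x) = (x / s) D\<^sub>x\<^sub>s(\<bar>f\<bar>\<^sup>2\<^sup>x\<^sup>-\<^sup>2 \<bar>f'\<bar>\<^sup>2) + x s D\<^sub>x\<^sub>s\<^sub>-\<^sub>1(\<bar>f\<bar>\<^sup>2\<^sup>x)\<close>.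
  On the right hand side both factors are proportional to \<open>x\<close>, both integrals have integrands that
  are geometric interpolations in \<open>x\<close>, and both converge for \<open>x s = 1\<close>, where the right hand side
  is the squared Hardy norm.  Young's inequality with weights \<open>k - x\<close> and \<open>x - (k - 1)\<close> then costs
  precisely the factor \<open>C = x / ((k - 1)\<^sup>k\<^sup>-\<^sup>x k\<^sup>x\<^sup>-\<^sup>k\<^sup>+\<^sup>1)\<close> (\<open>bergman_interpolation_bound\<close>), and \<open>C\<^sup>1\<^sup>/\<^sup>p\<close> is the
  constant of the theorem.

  Only the inequality from left to right is needed for real \<open>x\<close>.  For integer exponents Green's
  formula is a comparison of Taylor coefficients; by linearity it extends to polynomials in
  \<open>\<bar>f\<bar>\<^sup>2\<close>, and by the Weierstrass theorem to \<open>\<bar>f\<bar>\<^sup>2\<^sup>x\<close> (\<open>disc_integral_powr_le\<close>).  In this way the zeros of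
  \<open>f\<close>, where \<open>\<bar>f\<bar>\<^sup>2\<^sup>x\<close> need not be smooth, cause no difficulty.

  All of this is done for functions holomorphic beyond the closed disc.  A general \<open>f\<close> is approximated
  by its dilates \<open>z \<mapsto> f (r z)\<close>, whose coefficient sums stay below \<open>\<parallel>f\<parallel>\<^sup>2\<close>, and Fatou's lemma gives both
  integrability and the bound for \<open>f\<close> itself.
\<close>

section \<open>Rotation invariance of the area measure\<close>

lemma lborel_complex_eq_distr_pair:
  "(lborel :: complex measure) = distr (lborel \<Otimes>\<^sub>M lborel) borel (\<lambda>(x, y). Complex x y)"
proof (rule lborel_eqI)
  have meas: "(\<lambda>(x, y). Complex x y) \<in> borel_measurable (lborel \<Otimes>\<^sub>M lborel)"
    by (auto simp: borel_measurable_complex_iff split_beta)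
  fix l u :: complex
  assume "\<And>b. b \<in> Basis \<Longrightarrow> l \<bullet> b \<le> u \<bullet> b"
  from this[of 1] this[of \<i>] have le: "Re l \<le> Re u" "Im l \<le> Im u"
    by simp_all
  have "emeasure (distr (lborel \<Otimes>\<^sub>M lborel) borel (\<lambda>(x, y). Complex x y)) (box l u) =
        emeasure (lborel \<Otimes>\<^sub>M lborel) ({Re l<..<Re u} \<times> {Im l<..<Im u})"
    using meas by (subst emeasure_distr)
      (auto intro!: arg_cong2[where f=emeasure] simp: box_def Basis_complex_def space_pair_measure)
  also have "\<dots> = ennreal (Re u - Re l) * ennreal (Im u - Im l)"
    using le by (subst lborel.emeasure_pair_measure_Times) auto
  also have "\<dots> = (\<Prod>b\<in>Basis. (u - l) \<bullet> b)"
    using le by (simp add: Basis_complex_def ennreal_mult inner_complex_def)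
  finally show "emeasure (distr (lborel \<Otimes>\<^sub>M lborel) borel (\<lambda>(x, y). Complex x y)) (box l u) =
     (\<Prod>b\<in>Basis. (u - l) \<bullet> b)" .
qed simp

lemma measurable_Complex [measurable]:
  "f \<in> borel_measurable M \<Longrightarrow> g \<in> borel_measurable M \<Longrightarrow> (\<lambda>x. Complex (f x) (g x)) \<in> borel_measurable M"
  by (simp add: borel_measurable_complex_iff)

text \<open>
  Tonelli's theorem in the coordinates \<open>Re\<close> and \<open>Im\<close>, in both orders, so that a shear along either
  axis becomes a translation of the inner integral.
\<close>

lemma nn_integral_complex_iterated:
  fixes g :: "complex \<Rightarrow> ennreal"
  assumes [measurable]: "g \<in> borel_measurable borel"
  shows nn_integral_complex_Re_Im: "(\<integral>\<^sup>+z. g z \<partial>lborel) = (\<integral>\<^sup>+x. \<integral>\<^sup>+y. g (Complex x y) \<partial>lborel \<partial>lborel)"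
    and nn_integral_complex_Im_Re: "(\<integral>\<^sup>+z. g z \<partial>lborel) = (\<integral>\<^sup>+y. \<integral>\<^sup>+x. g (Complex x y) \<partial>lborel \<partial>lborel)"
proof -
  have "(\<integral>\<^sup>+z. g z \<partial>lborel) = (\<integral>\<^sup>+p. g (Complex (fst p) (snd p)) \<partial>(lborel \<Otimes>\<^sub>M lborel))"
    unfolding lborel_complex_eq_distr_pair by (subst nn_integral_distr) (auto simp: split_beta)
  then show "(\<integral>\<^sup>+z. g z \<partial>lborel) = (\<integral>\<^sup>+x. \<integral>\<^sup>+y. g (Complex x y) \<partial>lborel \<partial>lborel)"
    and "(\<integral>\<^sup>+z. g z \<partial>lborel) = (\<integral>\<^sup>+y. \<integral>\<^sup>+x. g (Complex x y) \<partial>lborel \<partial>lborel)"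
    using lborel.nn_integral_fst[of "\<lambda>p. g (Complex (fst p) (snd p))" lborel]
      lborel_pair.nn_integral_snd[of "\<lambda>p. g (Complex (fst p) (snd p))"]
    by simp_all
qed

lemma nn_integral_shear_Re:
  assumes [measurable]: "g \<in> borel_measurable borel"
  shows "(\<integral>\<^sup>+z. g (z + of_real (a * Im z)) \<partial>lborel) = (\<integral>\<^sup>+z. g z \<partial>lborel)"
proof -
  have "(\<integral>\<^sup>+x. g (Complex (x + a * y) y) \<partial>lborel) = (\<integral>\<^sup>+x. g (Complex x y) \<partial>lborel)" for y
    using nn_integral_real_affine[of "\<lambda>x. g (Complex x y)" 1 "a * y"] by (simp add: add.commute)
  moreover have "Complex x y + of_real (a * Im (Complex x y)) = Complex (x + a * y) y" for x y
    by (simp add: complex_eq_iff)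
  ultimately show ?thesis
    by (simp add: nn_integral_complex_Im_Re del: of_real_mult complex.sel)
qed

lemma nn_integral_shear_Im:
  assumes [measurable]: "g \<in> borel_measurable borel"
  shows "(\<integral>\<^sup>+z. g (z + \<i> * of_real (a * Re z)) \<partial>lborel) = (\<integral>\<^sup>+z. g z \<partial>lborel)"
proof -
  have "(\<integral>\<^sup>+y. g (Complex x (y + a * x)) \<partial>lborel) = (\<integral>\<^sup>+y. g (Complex x y) \<partial>lborel)" for x
    using nn_integral_real_affine[of "\<lambda>y. g (Complex x y)" 1 "a * x"] by (simp add: add.commute)
  moreover have "Complex x y + \<i> * of_real (a * Re (Complex x y)) = Complex x (y + a * x)" for x y
    by (simp add: complex_eq_iff)
  ultimately show ?thesis
    by (simp add: nn_integral_complex_Re_Im del: of_real_mult complex.sel)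
qed

text \<open>
  A rotation by an angle that is not a multiple of \<open>\<pi>\<close> is a product of three shears, each of
  which preserves area.
\<close>

lemma distr_lborel_rotation:
  assumes c: "cmod c = 1" "Im c \<noteq> 0"
  shows "distr lborel borel ((*) c) = lborel"
proof (rule measure_eqI)
  fix A assume "A \<in> sets (distr lborel borel ((*) c))"
  then have [measurable]: "A \<in> sets borel" by simp
  define a where "a = (Re c - 1) / Im c"
  define S where "S = (\<lambda>z. z + of_real (a * Im z))"
  define T where "T = (\<lambda>z. z + \<i> * of_real (Im c * Re z))"
  have sq: "(Re c)\<^sup>2 + (Im c)\<^sup>2 = 1"
    using c(1) by (metis cmod_power2 one_power2)
  have ab: "1 + a * Im c = Re c"
    using c(2) by (simp add: a_def)
  have "a * Im c * (1 + Re c) = - (Im c)\<^sup>2"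
  proof -
    have "a * Im c = Re c - 1" using ab by simp
    then have "a * Im c * (1 + Re c) = (Re c - 1) * (1 + Re c)" by (simp only:)
    also have "\<dots> = (Re c)\<^sup>2 - 1" by (simp add: power2_eq_square algebra_simps)
    finally have "a * Im c * (1 + Re c) = (Re c)\<^sup>2 - 1" .
    then show ?thesis using sq by simp
  qed
  then have "Im c * (a * (1 + Re c)) = Im c * (- Im c)"
    by (simp add: power2_eq_square mult_ac)
  then have "a * (1 + Re c) = - Im c"
    using c(2) by (simp only: mult_cancel_left) simp
  note corner = this
  have rot: "c * z = S (T (S z))" for z
  proof -
    have "Re (S (T (S z))) = (1 + a * Im c) * Re z + a * (1 + (1 + a * Im c)) * Im z"
      "Im (S (T (S z))) = Im c * Re z + (1 + a * Im c) * Im z"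
      unfolding S_def T_def by (simp_all add: algebra_simps)
    then show ?thesis by (simp add: ab corner complex_eq_iff)
  qed
  have [measurable]: "S \<in> borel_measurable borel" "T \<in> borel_measurable borel"
    unfolding S_def T_def by measurable
  have "emeasure (distr lborel borel ((*) c)) A = (\<integral>\<^sup>+z. indicator A (S (T (S z))) \<partial>lborel)"
  proof -
    have "emeasure (distr lborel borel ((*) c)) A = (\<integral>\<^sup>+z. indicator A z \<partial>distr lborel borel ((*) c))"
      by simp
    also have "\<dots> = (\<integral>\<^sup>+z. indicator A (c * z) \<partial>lborel)"
      by (rule nn_integral_distr) measurable
    finally show ?thesis by (simp only: rot)
  qed
  also have "\<dots> = (\<integral>\<^sup>+z. indicator A (S (T z)) \<partial>lborel)"
    using nn_integral_shear_Re[of "\<lambda>z. indicator A (S (T z))" a] by (simp add: S_def)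
  also have "\<dots> = (\<integral>\<^sup>+z. indicator A (S z) \<partial>lborel)"
    using nn_integral_shear_Im[of "\<lambda>z. indicator A (S z)" "Im c"] by (simp add: T_def)
  also have "\<dots> = (\<integral>\<^sup>+z. indicator A z \<partial>lborel)"
    using nn_integral_shear_Re[of "\<lambda>z. indicator A z" a] by (simp add: S_def)
  finally show "emeasure (distr lborel borel ((*) c)) A = emeasure lborel A" by simp
qed simp

lemma borel_measurable_cnj [measurable]:
  "f \<in> borel_measurable M \<Longrightarrow> (\<lambda>x. cnj (f x)) \<in> borel_measurable M"
  by (simp add: borel_measurable_complex_iff)

text \<open>
  For \<open>n < m\<close> the rotation by \<open>\<pi> / (2 (m - n))\<close> preserves the measure and multiplies the integrand by
  \<open>-\<i>\<close>; the other case is its complex conjugate.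
\<close>

lemma integral_radial_orthogonal:
  fixes w :: "real \<Rightarrow> real"
  assumes "n \<noteq> m" and [measurable]: "w \<in> borel_measurable borel"
  shows "(LINT z|lborel. complex_of_real (w (cmod z)) * (z ^ n * cnj (z ^ m))) = 0"
proof -
  have *: "(LINT z|lborel. complex_of_real (w (cmod z)) * (z ^ n * cnj (z ^ m))) = 0"
    if "n < m" for n m :: nat
  proof -
    define c where "c = cis (pi / (2 * real (m - n)))"
    define h where "h = (\<lambda>z. complex_of_real (w (cmod z)) * (z ^ n * cnj (z ^ m)))"
    have "0 < sin (pi / (2 * real (m - n)))"
    proof (rule sin_gt_zero)
      have "pi / (2 * real (m - n)) \<le> pi / 2"
        using that by (intro divide_left_mono) auto
      also have "pi / 2 < pi" by simp
      finally show "pi / (2 * real (m - n)) < pi" .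
    qed (use that in simp)
    then have c: "cmod c = 1" "Im c \<noteq> 0" by (auto simp: c_def)
    have "real (m - n) * (pi / (2 * real (m - n))) = pi / 2"
      using that by (simp del: of_nat_diff)
    then have "c ^ (m - n) = \<i>"
      by (simp only: c_def Complex.DeMoivre cis_pi_half)
    then have cm: "cnj (c ^ m) = cnj (c ^ n) * - \<i>"
      using that by (metis complex_cnj_i complex_cnj_mult le_add_diff_inverse less_imp_le power_add)
    have one: "c ^ n * cnj (c ^ n) = 1"
      by (metis c(1) complex_norm_square norm_power of_real_1 power_one)
    have hc: "h (c * z) = - \<i> * h z" for z
    proof -
      have "h (c * z) = (c ^ n * cnj (c ^ m)) * h z"
        using c(1) by (simp add: h_def norm_mult power_mult_distrib algebra_simps)
      also have "c ^ n * cnj (c ^ m) = - \<i>"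
        by (simp only: cm mult.assoc[symmetric] one mult_1)
      finally show ?thesis .
    qed
    have "integral\<^sup>L lborel h = integral\<^sup>L (distr lborel borel ((*) c)) h"
      using c by (simp add: distr_lborel_rotation)
    also have "\<dots> = (LINT z|lborel. h (c * z))"
      unfolding h_def by (rule integral_distr) measurable
    also have "\<dots> = - \<i> * integral\<^sup>L lborel h"
      by (simp add: hc)
    finally have "integral\<^sup>L lborel h * (1 + \<i>) = 0"
      by (simp add: algebra_simps eq_neg_iff_add_eq_0)
    then show ?thesis by (auto simp: h_def complex_eq_iff)
  qed
  show ?thesis
  proof (cases "n < m")
    case True then show ?thesis by (rule *)
  next
    case False
    with assms have "m < n" by simp
    have "(LINT z|lborel. complex_of_real (w (cmod z)) * (z ^ n * cnj (z ^ m))) =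
        (LINT z|lborel. cnj (complex_of_real (w (cmod z)) * (z ^ m * cnj (z ^ n))))"
      by (simp add: mult.commute)
    also have "\<dots> = cnj (LINT z|lborel. complex_of_real (w (cmod z)) * (z ^ m * cnj (z ^ n)))"
      by (rule Bochner_Integration.integral_cnj)
    finally show ?thesis using *[OF \<open>m < n\<close>] by simp
  qed
qed

section \<open>Radial integrals\<close>

text \<open>
  Integration of radial functions in the variable \<open>t = \<bar>z\<bar>\<^sup>2\<close>: since the disc \<open>\<bar>z\<bar>\<^sup>2 \<le> t\<close> has area
  \<open>\<pi> t\<close>, the area measure is carried to \<open>\<pi> dt\<close> on the half line.
\<close>

lemma distr_lborel_cmod_power2:
  "distr lborel borel (\<lambda>z. (cmod z)\<^sup>2) = density lborel (\<lambda>t. ennreal (pi * indicator {0..} t))"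
    (is "?M = ?N")
proof (rule measure_eqI_generator_eq[where E="range atMost" and A="\<lambda>i::nat. {..real i}" and \<Omega>=UNIV])
  have emM: "emeasure ?M {..x} = ennreal (pi * max 0 x)" for x
  proof -
    have "emeasure ?M {..x} = emeasure lborel {z. (cmod z)\<^sup>2 \<le> x}"
      by (subst emeasure_distr) (auto intro!: arg_cong2[where f=emeasure])
    also have "\<dots> = ennreal (pi * max 0 x)"
    proof (cases "x < 0")
      case True
      then have "{z. (cmod z)\<^sup>2 \<le> x} = {}"
        by (auto simp: not_le intro: order_less_le_trans)
      with True show ?thesis by simp
    next
      case False
      then have "{z. (cmod z)\<^sup>2 \<le> x} = cball 0 (sqrt x)"
        by (auto simp: real_le_rsqrt) (use real_le_rsqrt sqrt_ge_absD in force)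
      moreover have "unit_ball_vol 2 = pi"
        using unit_ball_vol_even[of 1] by simp
      ultimately show ?thesis using False
        by (simp add: emeasure_cball)
    qed
    finally show ?thesis .
  qed
  have emN: "emeasure ?N {..x} = ennreal (pi * max 0 x)" for x
  proof -
    have "emeasure ?N {..x} = (\<integral>\<^sup>+t. ennreal pi * indicator {0..x} t \<partial>lborel)"
      by (subst emeasure_density) (auto intro!: nn_integral_cong split: split_indicator)
    also have "\<dots> = ennreal (pi * max 0 x)"
      by (subst nn_integral_cmult_indicator) (auto simp: ennreal_mult max_def)
    finally show ?thesis .
  qed
  show "emeasure ?M X = emeasure ?N X" if "X \<in> range atMost" for X
    using that emM emN by auto
  show "emeasure ?M {..real i} \<noteq> \<infinity>" for i by (simp add: emM)
  show "Int_stable (range atMost :: real set set)"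
    by (auto simp: Int_stable_def)
  show "(\<Union>i. {..real i}) = UNIV"
    using real_arch_simple by auto
  show "sets ?M = sigma_sets UNIV (range atMost)" "sets ?N = sigma_sets UNIV (range atMost)"
    by (simp_all add: borel_eq_atMost)
qed auto

lemma has_bochner_integral_disc_moment:
  assumes "\<beta> > -1"
  shows "has_bochner_integral lborel
           (\<lambda>z. indicator (ball 0 1) z * (1 - (cmod z)\<^sup>2) powr \<beta> * (cmod z)\<^sup>2 ^ n)
           (pi * Beta (real n + 1) (\<beta> + 1))"
proof -
  define g where "g = (\<lambda>t::real. indicator {0..<1} t * (1 - t) powr \<beta> * t ^ n)"
  have [measurable]: "g \<in> borel_measurable borel" unfolding g_def by measurable
  have g0: "g t \<ge> 0" for t by (auto simp: g_def split: split_indicator)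
  have gz: "indicator (ball 0 1) z * (1 - (cmod z)\<^sup>2) powr \<beta> * (cmod z)\<^sup>2 ^ n = g ((cmod z)\<^sup>2)" for z
    by (auto simp: g_def abs_square_less_1 split: split_indicator)
  have "((\<lambda>t. t powr (real n + 1 - 1) * (1 - t) powr (\<beta> + 1 - 1)) has_integral Beta (real n + 1) (\<beta> + 1)) {0..1}"
    using assms by (intro has_integral_Beta_real) auto
  then have "(g has_integral Beta (real n + 1) (\<beta> + 1)) {0..1}"
    by (rule has_integral_spike_finite[of "{0,1}", rotated 2])
       (auto simp: g_def powr_realpow mult.commute)
  from nn_integral_has_integral_lebesgue'[OF _ this]
  have "(\<integral>\<^sup>+t. ennreal (g t) * indicator {0..1} t \<partial>lborel) = ennreal (Beta (real n + 1) (\<beta> + 1))"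
    using g0 by auto
  also have "(\<integral>\<^sup>+t. ennreal (g t) * indicator {0..1} t \<partial>lborel) = (\<integral>\<^sup>+t. ennreal (g t) \<partial>lborel)"
    by (intro nn_integral_cong) (auto simp: g_def split: split_indicator)
  finally have gB: "(\<integral>\<^sup>+t. ennreal (g t) \<partial>lborel) = ennreal (Beta (real n + 1) (\<beta> + 1))" .
  have "(\<integral>\<^sup>+z. ennreal (g ((cmod z)\<^sup>2)) \<partial>lborel) = (\<integral>\<^sup>+t. ennreal (g t) \<partial>distr lborel borel (\<lambda>z. (cmod z)\<^sup>2))"
    by (subst nn_integral_distr) auto
  also have "\<dots> = (\<integral>\<^sup>+t. ennreal pi * ennreal (g t) \<partial>lborel)"
    by (auto simp: distr_lborel_cmod_power2 nn_integral_density g_def intro!: nn_integral_cong split: split_indicator)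
  also have "\<dots> = ennreal (pi * Beta (real n + 1) (\<beta> + 1))"
    by (simp add: nn_integral_cmult gB ennreal_mult')
  finally show ?thesis
    unfolding gz using assms g0
    by (intro has_bochner_integral_nn_integral) (auto simp: Beta_def intro!: mult_nonneg_nonneg divide_nonneg_nonneg Gamma_real_nonneg)
qed

section \<open>Orthogonal series\<close>

text \<open>
  Parseval's identity for a series of orthogonal functions that converges absolutely and uniformly
  where the weight lives.  It serves the weighted disc, smaller concentric discs and circles alike.
\<close>

lemma orthogonal_series_sums:
  fixes W :: "'a \<Rightarrow> real" and e :: "nat \<Rightarrow> 'a \<Rightarrow> complex" and B :: "nat \<Rightarrow> real"
  assumes W: "integrable M W" "\<And>x. W x \<ge> 0"
    and e [measurable]: "\<And>n. e n \<in> borel_measurable M"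
    and B: "\<And>n x. W x \<noteq> 0 \<Longrightarrow> cmod (e n x) \<le> B n"
    and a: "summable (\<lambda>n. cmod (a n) * B n)"
    and f: "\<And>x. W x \<noteq> 0 \<Longrightarrow> (\<lambda>n. a n * e n x) sums f x"
    and orth: "\<And>n m. n \<noteq> m \<Longrightarrow> (LINT x|M. complex_of_real (W x) * (e n x * cnj (e m x))) = 0"
  shows integrable_orthogonal_series: "integrable M (\<lambda>x. W x * (cmod (f x))\<^sup>2)"
    and "(\<lambda>n. (cmod (a n))\<^sup>2 * (LINT x|M. W x * (cmod (e n x))\<^sup>2)) sums (LINT x|M. W x * (cmod (f x))\<^sup>2)"
proof -
  have [measurable]: "W \<in> borel_measurable M" using W by auto
  define s where "s = (\<lambda>N x. \<Sum>n<N. a n * e n x)"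
  define K where "K = (\<Sum>n. cmod (a n) * B n)"
  have [measurable]: "s N \<in> borel_measurable M" for N
    unfolding s_def by measurable
  have bound: "cmod (s N x) \<le> K" if "W x \<noteq> 0" for N x
  proof -
    have B0: "0 \<le> B n" for n using B[OF that, of n] norm_ge_zero order_trans by blast
    have "cmod (s N x) \<le> (\<Sum>n<N. cmod (a n) * B n)"
      unfolding s_def using B[OF that]
      by (intro sum_norm_le) (auto simp: norm_mult intro!: mult_left_mono)
    also have "\<dots> \<le> K"
      unfolding K_def using a B0 by (intro sum_le_suminf) auto
    finally show ?thesis .
  qed
  have int: "integrable M (\<lambda>x. complex_of_real (W x) * (e n x * cnj (e m x)))" for n m
  proof (rule Bochner_Integration.integrable_bound)
    show "integrable M (\<lambda>x. W x * (B n * B m))" using W by simp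
    show "AE x in M. norm (complex_of_real (W x) * (e n x * cnj (e m x))) \<le> norm (W x * (B n * B m))"
    proof (rule AE_I2)
      fix x
      show "norm (complex_of_real (W x) * (e n x * cnj (e m x))) \<le> norm (W x * (B n * B m))"
      proof (cases "W x = 0")
        case False
        have "0 \<le> B n" "0 \<le> B m" using B[OF False] norm_ge_zero order_trans by blast+
        then show ?thesis
          using B[OF False] by (auto simp: norm_mult abs_mult intro!: mult_left_mono mult_mono)
      qed simp
    qed
  qed measurable
  have partial: "(LINT x|M. W x * (cmod (s N x))\<^sup>2) = (\<Sum>n<N. (cmod (a n))\<^sup>2 * (LINT x|M. W x * (cmod (e n x))\<^sup>2))" for N
  proof -
    have "complex_of_real (W x * (cmod (s N x))\<^sup>2) = complex_of_real (W x) * (s N x * cnj (s N x))" for x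
      by (simp only: of_real_mult complex_norm_square)
    then have "complex_of_real (LINT x|M. W x * (cmod (s N x))\<^sup>2) = (LINT x|M. complex_of_real (W x) * (s N x * cnj (s N x)))"
      by (simp only: integral_complex_of_real[symmetric])
    also have "\<dots> = (LINT x|M. (\<Sum>n<N. \<Sum>m<N. (a n * cnj (a m)) * (complex_of_real (W x) * (e n x * cnj (e m x)))))"
    proof (intro Bochner_Integration.integral_cong refl)
      fix x
      have "s N x * cnj (s N x) = (\<Sum>n<N. \<Sum>m<N. (a n * e n x) * (cnj (a m) * cnj (e m x)))"
        by (simp only: s_def cnj_sum complex_cnj_mult sum_product)
      then show "complex_of_real (W x) * (s N x * cnj (s N x)) =
          (\<Sum>n<N. \<Sum>m<N. (a n * cnj (a m)) * (complex_of_real (W x) * (e n x * cnj (e m x))))"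
        by (simp only: sum_distrib_left mult_ac)
    qed
    also have "\<dots> = (\<Sum>n<N. \<Sum>m<N. (a n * cnj (a m)) * (LINT x|M. complex_of_real (W x) * (e n x * cnj (e m x))))"
      using int by (simp add: Bochner_Integration.integral_sum)
    also have "\<dots> = (\<Sum>n<N. \<Sum>m<N. if n = m then (a n * cnj (a n)) * (LINT x|M. complex_of_real (W x) * (e n x * cnj (e n x))) else 0)"
      by (intro sum.cong refl) (simp add: orth)
    also have "\<dots> = (\<Sum>n<N. (a n * cnj (a n)) * (LINT x|M. complex_of_real (W x) * (e n x * cnj (e n x))))"
      by simp
    also have "\<dots> = complex_of_real (\<Sum>n<N. (cmod (a n))\<^sup>2 * (LINT x|M. W x * (cmod (e n x))\<^sup>2))"
      by (simp add: complex_norm_square[symmetric] integral_complex_of_real[symmetric] del: integral_complex_of_real)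
    finally show ?thesis using of_real_eq_iff by blast
  qed
  have lim: "(\<lambda>N. W x * (cmod (s N x))\<^sup>2) \<longlonglongrightarrow> W x * (cmod (f x))\<^sup>2" for x
  proof (cases "W x = 0")
    case False
    have "(\<lambda>N. s N x) \<longlonglongrightarrow> f x" using f[OF False] by (simp add: s_def sums_def)
    then show ?thesis by (intro tendsto_intros)
  qed simp
  have meas: "(\<lambda>x. W x * (cmod (f x))\<^sup>2) \<in> borel_measurable M"
    by (rule borel_measurable_LIMSEQ_real[OF lim]) measurable
  have dom: "norm (W x * (cmod (s N x))\<^sup>2) \<le> W x * K\<^sup>2" for N x
  proof (cases "W x = 0")
    case False
    then show ?thesis using W(2)[of x] bound[OF False]
      by (auto simp: abs_mult intro!: mult_left_mono power_mono)
  qed simp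
  have intK: "integrable M (\<lambda>x. W x * K\<^sup>2)" using W by simp
  show "integrable M (\<lambda>x. W x * (cmod (f x))\<^sup>2)"
    by (rule integrable_dominated_convergence[OF meas _ intK, of "\<lambda>N x. W x * (cmod (s N x))\<^sup>2"])
       (use lim dom in auto)
  have "(\<lambda>N. LINT x|M. W x * (cmod (s N x))\<^sup>2) \<longlonglongrightarrow> (LINT x|M. W x * (cmod (f x))\<^sup>2)"
    by (rule integral_dominated_convergence[OF meas _ intK])
       (use lim dom in auto)
  then show "(\<lambda>n. (cmod (a n))\<^sup>2 * (LINT x|M. W x * (cmod (e n x))\<^sup>2)) sums (LINT x|M. W x * (cmod (f x))\<^sup>2)"
    by (simp add: sums_def partial)
qed

section \<open>Taylor coefficients\<close>

definition taylor_coeff :: "(complex \<Rightarrow> complex) \<Rightarrow> nat \<Rightarrow> complex" where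
  "taylor_coeff f n = (deriv ^^ n) f 0 / fact n"

lemma taylor_coeff_sums:
  assumes "f holomorphic_on ball 0 R" "cmod z < R"
  shows "(\<lambda>n. taylor_coeff f n * z ^ n) sums f z"
  using holomorphic_power_series[OF assms(1), of z] assms(2) by (simp add: taylor_coeff_def)

lemma summable_taylor_coeff:
  assumes "f holomorphic_on ball 0 R" "0 \<le> \<rho>" "\<rho> < R"
  shows "summable (\<lambda>n. cmod (taylor_coeff f n) * \<rho> ^ n)"
proof -
  obtain r where r: "\<rho> < r" "r < R" using dense[OF assms(3)] by auto
  have "summable (\<lambda>n. taylor_coeff f n * of_real r ^ n)"
    using taylor_coeff_sums[OF assms(1), of "of_real r"] r assms by (auto simp: sums_iff)
  from powser_insidea[OF this, of "of_real \<rho>"] show ?thesis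
    using r assms by (simp add: norm_mult norm_power)
qed

lemma taylor_coeff_mult:
  assumes "f holomorphic_on ball 0 R" "g holomorphic_on ball 0 R" "0 < R"
  shows "taylor_coeff (\<lambda>z. f z * g z) n = (\<Sum>i\<le>n. taylor_coeff f i * taylor_coeff g (n - i))"
proof -
  have "taylor_coeff (\<lambda>z. f z * g z) n =
      (\<Sum>i\<le>n. of_nat (n choose i) * (deriv ^^ i) f 0 * (deriv ^^ (n - i)) g 0 / fact n)"
    using assms by (simp add: taylor_coeff_def higher_deriv_mult[of f "ball 0 R"] atMost_atLeast0 sum_divide_distrib)
  also have "\<dots> = (\<Sum>i\<le>n. taylor_coeff f i * taylor_coeff g (n - i))"
    by (intro sum.cong) (auto simp: taylor_coeff_def binomial_fact)
  finally show ?thesis .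
qed

lemma taylor_coeff_deriv:
  "taylor_coeff (deriv f) n = of_nat (Suc n) * taylor_coeff f (Suc n)"
proof -
  have "(deriv ^^ n) (deriv f) = (deriv ^^ Suc n) f" by (simp add: funpow_swap1)
  then show ?thesis by (simp add: taylor_coeff_def divide_simps del: of_nat_Suc funpow.simps)
qed

lemma taylor_coeff_dilate:
  assumes "f holomorphic_on ball 0 1" "0 < r" "r < 1"
  shows "taylor_coeff (\<lambda>z. f (of_real r * z)) n = of_real r ^ n * taylor_coeff f n"
proof -
  have "(deriv ^^ n) (\<lambda>z. f (of_real r * z)) 0 = of_real r ^ n * (deriv ^^ n) f (of_real r * 0)"
    by (rule higher_deriv_compose_linear[where S="ball 0 1" and T="ball 0 1"])
       (use assms in \<open>auto simp: norm_mult intro: le_less_trans[OF mult_left_le_one_le]\<close>)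
  then show ?thesis by (simp add: taylor_coeff_def)
qed

section \<open>Weighted area integrals and coefficient sums\<close>

definition disc_integral :: "real \<Rightarrow> (complex \<Rightarrow> real) \<Rightarrow> real" where
  "disc_integral \<beta> h = 1 / pi * (LINT z:ball 0 1|lborel. (1 - (cmod z)\<^sup>2) powr \<beta> * h z)"

text \<open>
  The squared norm of \<open>A\<^sup>2\<close> with parameter \<open>\<sigma> - 2\<close> in terms of Taylor coefficients; at \<open>\<sigma> = 1\<close> it is
  the squared Hardy norm.  The weights are the reciprocals of the coefficients of \<open>(1 - X)\<^sup>-\<^sup>\<sigma>\<close>.
\<close>

definition coeff_energy :: "real \<Rightarrow> (complex \<Rightarrow> complex) \<Rightarrow> real" where
  "coeff_energy \<sigma> f = (\<Sum>n. (cmod (taylor_coeff f n))\<^sup>2 * (fact n / pochhammer \<sigma> n))"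

lemma disc_moment_eq:
  assumes "\<beta> > -1"
  shows "(\<beta> + 1) * Beta (real n + 1) (\<beta> + 1) = fact n / pochhammer (\<beta> + 2) n"
proof -
  have "\<beta> + 1 \<notin> \<int>\<^sub>\<le>\<^sub>0" using assms by (auto simp: nonpos_Ints_def)
  then have 1: "Gamma (\<beta> + 2) = (\<beta> + 1) * Gamma (\<beta> + 1)"
    using Gamma_plus1[of "\<beta> + 1"] by (simp add: add_ac)
  have 2: "pochhammer (\<beta> + 2) n = Gamma (\<beta> + 2 + real n) / Gamma (\<beta> + 2)"
    using assms by (intro pochhammer_Gamma) (auto simp: nonpos_Ints_def)
  have 3: "Gamma (real n + 1) = fact n"
    using Gamma_fact[of n, where 'a=real] by (simp add: add.commute)
  have 4: "real n + 1 + (\<beta> + 1) = \<beta> + 2 + real n" by simp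
  show ?thesis by (simp only: Beta_def 1 2 3 4) simp
qed

lemma bergman_Parseval:
  assumes f: "f holomorphic_on ball 0 R" "1 < R" and \<beta>: "\<beta> > -1"
  shows "(\<lambda>n. (cmod (taylor_coeff f n))\<^sup>2 * (fact n / pochhammer (\<beta> + 2) n)) sums
           ((\<beta> + 1) * disc_integral \<beta> (\<lambda>z. (cmod (f z))\<^sup>2))"
proof -
  define w where "w = (\<lambda>t::real. (if t < 1 then (1 - t\<^sup>2) powr \<beta> else 0))"
  have [measurable]: "w \<in> borel_measurable borel" unfolding w_def by measurable
  have w: "indicator (ball 0 1) z * (1 - (cmod z)\<^sup>2) powr \<beta> = w (cmod z)" for z :: complex
    by (auto simp: w_def)
  note moment = has_bochner_integral_disc_moment[OF \<beta>, unfolded w]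
  have m: "(LINT z|lborel. w (cmod z) * (cmod (z ^ n))\<^sup>2) = pi * Beta (real n + 1) (\<beta> + 1)" for n
    using has_bochner_integral_integral_eq[OF moment[of n]] by (simp add: norm_power power_mult[symmetric] mult.commute)
  have "(\<lambda>n. (cmod (taylor_coeff f n))\<^sup>2 * (LINT z|lborel. w (cmod z) * (cmod (z ^ n))\<^sup>2)) sums
        (LINT z|lborel. w (cmod z) * (cmod (f z))\<^sup>2)"
  proof (rule orthogonal_series_sums(2)[where B="\<lambda>_. 1"])
    show "integrable lborel (\<lambda>z::complex. w (cmod z))"
      using has_bochner_integral_integrable moment[of 0] by (auto simp: has_bochner_integral_iff)
    show "cmod (z ^ n) \<le> 1" if "w (cmod z) \<noteq> 0" for n z
      using that by (auto simp: w_def norm_power power_le_one_iff split: if_splits)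
    show "summable (\<lambda>n. cmod (taylor_coeff f n) * 1)"
      using summable_taylor_coeff[OF f(1), of 1] f by simp
    show "(\<lambda>n. taylor_coeff f n * z ^ n) sums f z" if "w (cmod z) \<noteq> 0" for z
      by (rule taylor_coeff_sums[OF f(1)]) (use that f(2) in \<open>auto simp: w_def split: if_splits\<close>)
    show "(LINT z|lborel. complex_of_real (w (cmod z)) * (z ^ n * cnj (z ^ m))) = 0" if "n \<noteq> m" for n m
      using that by (rule integral_radial_orthogonal) measurable
  qed (auto simp: w_def)
  from sums_mult[OF this[unfolded m], of "(\<beta> + 1) / pi"] have
    "(\<lambda>n. (cmod (taylor_coeff f n))\<^sup>2 * ((\<beta> + 1) * Beta (real n + 1) (\<beta> + 1))) sums
       ((\<beta> + 1) * (1 / pi * (LINT z|lborel. w (cmod z) * (cmod (f z))\<^sup>2)))"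
    by (simp add: mult_ac)
  then show ?thesis
    by (simp only: disc_moment_eq[OF \<beta>] disc_integral_def set_lebesgue_integral_def real_scaleR_def mult.assoc[symmetric] w)
qed

text \<open>
  The Taylor series of \<open>f\<close> need not converge absolutely on the closed disc.  Parseval's identity is
  therefore used on the discs of radius \<open>\<rho> < 1\<close>, and the moments of these discs increase to those of
  the unit disc as \<open>\<rho>\<close> tends to 1.
\<close>

lemma bergman_Bessel:
  assumes f: "f holomorphic_on ball 0 1" and \<beta>: "\<beta> > -1"
    and int: "set_integrable lborel (ball 0 1) (\<lambda>z. (1 - (cmod z)\<^sup>2) powr \<beta> * (cmod (f z))\<^sup>2)"
  shows "(\<Sum>n<N. (cmod (taylor_coeff f n))\<^sup>2 * (fact n / pochhammer (\<beta> + 2) n)) \<le>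
           (\<beta> + 1) * disc_integral \<beta> (\<lambda>z. (cmod (f z))\<^sup>2)"
proof -
  define w where "w = (\<lambda>\<rho> t::real. (if t < \<rho> then (1 - t\<^sup>2) powr \<beta> else 0))"
  have [measurable]: "w \<rho> \<in> borel_measurable borel" for \<rho> unfolding w_def by measurable
  have w: "indicator (ball 0 1) z * (1 - (cmod z)\<^sup>2) powr \<beta> = w 1 (cmod z)" for z :: complex
    by (auto simp: w_def)
  note moment = has_bochner_integral_disc_moment[OF \<beta>, unfolded w]
  have int': "integrable lborel (\<lambda>z. w 1 (cmod z) * (cmod (f z))\<^sup>2)"
    using int by (simp only: set_integrable_def real_scaleR_def mult.assoc[symmetric] w)
  have m: "(LINT z|lborel. w 1 (cmod z) * (cmod (z ^ n))\<^sup>2) = pi * Beta (real n + 1) (\<beta> + 1)"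
    and mi: "integrable lborel (\<lambda>z. w 1 (cmod z) * (cmod (z ^ n))\<^sup>2)" for n
    using moment[of n] by (simp_all add: has_bochner_integral_iff norm_power power_mult[symmetric] mult.commute)
  have w_le: "w \<rho> t \<le> w 1 t" "0 \<le> w \<rho> t" if "\<rho> \<le> 1" for \<rho> t using that by (auto simp: w_def)
  have bessel: "(\<Sum>n<N. (cmod (taylor_coeff f n))\<^sup>2 * (LINT z|lborel. w \<rho> (cmod z) * (cmod (z ^ n))\<^sup>2)) \<le>
        (LINT z|lborel. w 1 (cmod z) * (cmod (f z))\<^sup>2)" if \<rho>: "0 < \<rho>" "\<rho> < 1" for \<rho>
  proof -
    have int\<rho>: "integrable lborel (\<lambda>z::complex. w \<rho> (cmod z))"
      by (rule Bochner_Integration.integrable_bound[OF mi[of 0]])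
         (use w_le[of \<rho>] \<rho> in \<open>auto intro!: AE_I2 order_trans[OF _ abs_ge_self]\<close>)
    have *: "cmod (z ^ n) \<le> \<rho> ^ n"
      "(\<lambda>n. taylor_coeff f n * z ^ n) sums f z"
      if "w \<rho> (cmod z) \<noteq> 0" for n z
      using that \<rho> f by (auto simp: w_def norm_power intro!: power_mono taylor_coeff_sums split: if_splits)
    have summable: "summable (\<lambda>n. cmod (taylor_coeff f n) * \<rho> ^ n)"
      using summable_taylor_coeff[OF f] \<rho> by simp
    have orth: "(LINT z|lborel. complex_of_real (w \<rho> (cmod z)) * (z ^ n * cnj (z ^ m))) = 0" if "n \<noteq> m" for n m
      using that by (rule integral_radial_orthogonal) measurable
    note os = orthogonal_series_sums[where e="\<lambda>n z. z ^ n" and a="taylor_coeff f" and B="\<lambda>n. \<rho> ^ n" and f=f, OF int\<rho> _ _ *(1) summable *(2) orth]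
    have osum: "(\<lambda>n. (cmod (taylor_coeff f n))\<^sup>2 * (LINT z|lborel. w \<rho> (cmod z) * (cmod (z ^ n))\<^sup>2)) sums
        (LINT z|lborel. w \<rho> (cmod z) * (cmod (f z))\<^sup>2)"
      by (rule os(2)) (use \<rho> w_le in auto)
    have oint: "integrable lborel (\<lambda>z. w \<rho> (cmod z) * (cmod (f z))\<^sup>2)"
      by (rule os(1)) (use \<rho> w_le in auto)
    have "(\<Sum>n<N. (cmod (taylor_coeff f n))\<^sup>2 * (LINT z|lborel. w \<rho> (cmod z) * (cmod (z ^ n))\<^sup>2)) \<le>
        (LINT z|lborel. w \<rho> (cmod z) * (cmod (f z))\<^sup>2)"
      by (subst sums_unique[OF osum], rule sum_le_suminf)
         (use osum \<rho> w_le in \<open>auto simp: sums_iff intro!: mult_nonneg_nonneg integral_nonneg_AE\<close>)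
    also have "\<dots> \<le> (LINT z|lborel. w 1 (cmod z) * (cmod (f z))\<^sup>2)"
      by (rule integral_mono[OF oint int']) (use \<rho> w_le in \<open>auto intro!: mult_right_mono\<close>)
    finally show ?thesis .
  qed
  define \<rho> where "\<rho> = (\<lambda>k::nat. 1 - 1 / (real k + 2))"
  have \<rho>: "0 < \<rho> k" "\<rho> k < 1" for k by (auto simp: \<rho>_def field_simps)
  have \<rho>_lim: "\<rho> \<longlonglongrightarrow> 1"
    unfolding \<rho>_def by real_asymp
  have lim: "(\<lambda>k. LINT z|lborel. w (\<rho> k) (cmod z) * (cmod (z ^ n))\<^sup>2) \<longlonglongrightarrow> pi * Beta (real n + 1) (\<beta> + 1)" for n
    unfolding m[symmetric]
  proof (rule integral_dominated_convergence[OF _ _ mi[of n]])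
    show "AE z in lborel. (\<lambda>k. w (\<rho> k) (cmod z) * (cmod (z ^ n))\<^sup>2) \<longlonglongrightarrow> w 1 (cmod z) * (cmod (z ^ n))\<^sup>2"
    proof (rule AE_I2)
      fix z :: complex
      have "\<forall>\<^sub>F k in sequentially. w (\<rho> k) (cmod z) = w 1 (cmod z)"
      proof (cases "cmod z < 1")
        case True
        from order_tendstoD(1)[OF \<rho>_lim this] show ?thesis
          by eventually_elim (auto simp: w_def True)
      next
        case False
        then have "\<not> cmod z < \<rho> k" for k using \<rho>(2)[of k] by linarith
        with False show ?thesis by (simp add: w_def)
      qed
      then have "\<forall>\<^sub>F k in sequentially. w (\<rho> k) (cmod z) * (cmod (z ^ n))\<^sup>2 = w 1 (cmod z) * (cmod (z ^ n))\<^sup>2"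
        by eventually_elim simp
      then show "(\<lambda>k. w (\<rho> k) (cmod z) * (cmod (z ^ n))\<^sup>2) \<longlonglongrightarrow> w 1 (cmod z) * (cmod (z ^ n))\<^sup>2"
        by (rule tendsto_eventually)
    qed
    show "AE z in lborel. norm (w (\<rho> k) (cmod z) * (cmod (z ^ n))\<^sup>2) \<le> w 1 (cmod z) * (cmod (z ^ n))\<^sup>2" for k
      using w_le[OF less_imp_le[OF \<rho>(2)]] by (auto intro!: mult_right_mono)
  qed auto
  have "(\<Sum>n<N. (cmod (taylor_coeff f n))\<^sup>2 * (pi * Beta (real n + 1) (\<beta> + 1))) \<le>
        (LINT z|lborel. w 1 (cmod z) * (cmod (f z))\<^sup>2)"
    by (rule LIMSEQ_le_const2[OF tendsto_sum[OF tendsto_mult_left[OF lim]]]) (use bessel \<rho> in auto)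
  from mult_left_mono[OF this, of "(\<beta> + 1) / pi"] \<beta> have
    "(\<Sum>n<N. (cmod (taylor_coeff f n))\<^sup>2 * ((\<beta> + 1) * Beta (real n + 1) (\<beta> + 1))) \<le>
      (\<beta> + 1) * (1 / pi * (LINT z|lborel. w 1 (cmod z) * (cmod (f z))\<^sup>2))"
    by (simp add: sum_distrib_left mult_ac)
  then show ?thesis
    by (simp only: disc_moment_eq[OF \<beta>] disc_integral_def set_lebesgue_integral_def real_scaleR_def mult.assoc[symmetric] w)
qed

section \<open>Coefficient sums of products and powers\<close>

lemma fact_le_pochhammer:
  assumes "1 \<le> (\<sigma>::real)"
  shows "fact n \<le> pochhammer \<sigma> n"
proof (induction n)
  case (Suc n)
  have "fact (Suc n) = fact n * (1 + real n)" by simp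
  also have "\<dots> \<le> pochhammer \<sigma> n * (\<sigma> + real n)"
    using Suc assms by (intro mult_mono) (auto intro: pochhammer_nonneg)
  also have "\<dots> = pochhammer \<sigma> (Suc n)" by (simp add: pochhammer_Suc)
  finally show ?case .
qed simp

lemma coeff_energy_summable:
  assumes f: "f holomorphic_on ball 0 R" "1 < R" and "1 \<le> \<sigma>"
  shows "summable (\<lambda>n. (cmod (taylor_coeff f n))\<^sup>2 * (fact n / pochhammer \<sigma> n))"
proof (rule summable_comparison_test_ev)
  have s: "summable (\<lambda>n. cmod (taylor_coeff f n))"
    using summable_taylor_coeff[OF f(1), of 1] f(2) by simp
  then show "summable (\<lambda>n. cmod (taylor_coeff f n))" .
  have "\<forall>\<^sub>F n in sequentially. cmod (taylor_coeff f n) < 1"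
    using order_tendstoD(2)[OF summable_LIMSEQ_zero[OF s], of 1] by simp
  then show "\<forall>\<^sub>F n in sequentially. norm ((cmod (taylor_coeff f n))\<^sup>2 * (fact n / pochhammer \<sigma> n)) \<le> cmod (taylor_coeff f n)"
  proof eventually_elim
    case (elim n)
    have "0 < pochhammer \<sigma> n" using assms by (intro pochhammer_pos) auto
    then have "0 \<le> fact n / pochhammer \<sigma> n" "fact n / pochhammer \<sigma> n \<le> 1"
      using fact_le_pochhammer[OF assms(3), of n] by auto
    then have "(cmod (taylor_coeff f n))\<^sup>2 * (fact n / pochhammer \<sigma> n) \<le> cmod (taylor_coeff f n) * 1"
      using elim by (intro mult_mono) (auto simp: power2_eq_square mult_left_le_one_le)
    with \<open>0 < pochhammer \<sigma> n\<close> show ?case by simp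
  qed
qed

text \<open>
  Let \<open>c\<close> and \<open>d\<close> be the coefficients of \<open>(1 - X)\<^sup>-\<^sup>\<sigma>\<close> and \<open>(1 - X)\<^sup>-\<^sup>\<tau>\<close>.  By the Cauchy-Schwarz inequality
  \<open>\<bar>\<Sum> a\<^sub>i b\<^sub>n\<^sub>-\<^sub>i\<bar>\<^sup>2 \<le> (\<Sum> c\<^sub>i d\<^sub>n\<^sub>-\<^sub>i) (\<Sum> (\<bar>a\<^sub>i\<bar>\<^sup>2 / c\<^sub>i) (\<bar>b\<^sub>n\<^sub>-\<^sub>i\<bar>\<^sup>2 / d\<^sub>n\<^sub>-\<^sub>i))\<close>.  By Vandermonde's identity
  the first factor is the coefficient of \<open>(1 - X)\<^sup>-\<^sup>(\<^sup>\<sigma>\<^sup>+\<^sup>\<tau>\<^sup>)\<close>, hence it cancels against the weight on the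
  left, and the second factors sum up to a Cauchy product.
\<close>

lemma coeff_energy_mult_le:
  assumes f: "f holomorphic_on ball 0 R" and g: "g holomorphic_on ball 0 R" and R: "1 < R"
    and \<sigma>: "1 \<le> \<sigma>" and \<tau>: "1 \<le> \<tau>"
  shows "coeff_energy (\<sigma> + \<tau>) (\<lambda>z. f z * g z) \<le> coeff_energy \<sigma> f * coeff_energy \<tau> g"
proof -
  define c where "c = (\<lambda>n. pochhammer \<sigma> n / fact n)"
  define d where "d = (\<lambda>n. pochhammer \<tau> n / fact n)"
  define u where "u = (\<lambda>n. (cmod (taylor_coeff f n))\<^sup>2 * (fact n / pochhammer \<sigma> n))"
  define v where "v = (\<lambda>n. (cmod (taylor_coeff g n))\<^sup>2 * (fact n / pochhammer \<tau> n))"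
  have pos: "0 < c n" "0 < d n" for n
    using \<sigma> \<tau> by (auto simp: c_def d_def intro!: divide_pos_pos pochhammer_pos)
  have uc: "u n * c n = (cmod (taylor_coeff f n))\<^sup>2" and vd: "v n * d n = (cmod (taylor_coeff g n))\<^sup>2" for n
    using pos[of n] by (auto simp: u_def v_def c_def d_def)
  have nonneg: "0 \<le> u n" "0 \<le> v n" for n
    using \<sigma> \<tau> by (auto simp: u_def v_def intro!: mult_nonneg_nonneg divide_nonneg_nonneg pochhammer_nonneg)
  have su: "summable (\<lambda>n. norm (u n))" "summable (\<lambda>n. norm (v n))"
    using coeff_energy_summable[OF f R \<sigma>, folded u_def] coeff_energy_summable[OF g R \<tau>, folded v_def] nonneg
    by simp_all
  have Vandermonde: "(\<Sum>i\<le>n. c i * d (n - i)) = pochhammer (\<sigma> + \<tau>) n / fact n" for n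
    unfolding pochhammer_binomial_sum sum_divide_distrib c_def d_def
    by (intro sum.cong) (auto simp: binomial_fact)
  have pos': "0 < pochhammer (\<sigma> + \<tau>) n" for n using \<sigma> \<tau> by (intro pochhammer_pos) auto
  have coeff: "(cmod (taylor_coeff (\<lambda>z. f z * g z) n))\<^sup>2 * (fact n / pochhammer (\<sigma> + \<tau>) n) \<le> (\<Sum>i\<le>n. u i * v (n - i))" for n
  proof -
    have "cmod (taylor_coeff (\<lambda>z. f z * g z) n) \<le> (\<Sum>i\<le>n. cmod (taylor_coeff f i) * cmod (taylor_coeff g (n - i)))"
      unfolding taylor_coeff_mult[OF f g less_trans[OF zero_less_one R]]
      by (intro sum_norm_le) (simp add: norm_mult)
    also have "\<dots> = (\<Sum>i\<le>n. sqrt (u i * v (n - i)) * sqrt (c i * d (n - i)))"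
    proof (intro sum.cong refl)
      fix i
      have "sqrt (u i * v (n - i)) * sqrt (c i * d (n - i)) = sqrt ((u i * c i) * (v (n - i) * d (n - i)))"
        by (simp add: real_sqrt_mult mult_ac)
      then show "cmod (taylor_coeff f i) * cmod (taylor_coeff g (n - i)) = sqrt (u i * v (n - i)) * sqrt (c i * d (n - i))"
        by (simp add: uc vd real_sqrt_mult)
    qed
    finally have "(cmod (taylor_coeff (\<lambda>z. f z * g z) n))\<^sup>2 \<le> (\<Sum>i\<le>n. sqrt (u i * v (n - i)) * sqrt (c i * d (n - i)))\<^sup>2"
      by (intro power_mono) auto
    also have "\<dots> \<le> (\<Sum>i\<le>n. (sqrt (u i * v (n - i)))\<^sup>2) * (\<Sum>i\<le>n. (sqrt (c i * d (n - i)))\<^sup>2)"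
      by (rule Cauchy_Schwarz_ineq_sum)
    also have "\<dots> = (\<Sum>i\<le>n. u i * v (n - i)) * (pochhammer (\<sigma> + \<tau>) n / fact n)"
      using nonneg pos by (simp add: Vandermonde[symmetric] less_imp_le)
    finally show ?thesis using pos'[of n] by (simp add: divide_simps mult_ac)
  qed
  have "coeff_energy (\<sigma> + \<tau>) (\<lambda>z. f z * g z) \<le> (\<Sum>n. \<Sum>i\<le>n. u i * v (n - i))"
    unfolding coeff_energy_def
  proof (rule suminf_le[OF coeff])
    show "summable (\<lambda>n. (cmod (taylor_coeff (\<lambda>z. f z * g z) n))\<^sup>2 * (fact n / pochhammer (\<sigma> + \<tau>) n))"
      using f g R \<sigma> \<tau> by (intro coeff_energy_summable[where R=R] holomorphic_intros) auto
  qed (use Cauchy_product_sums[OF su] in \<open>simp add: sums_iff\<close>)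
  also have "\<dots> = coeff_energy \<sigma> f * coeff_energy \<tau> g"
    using Cauchy_product_sums[OF su] by (simp add: sums_iff coeff_energy_def u_def v_def)
  finally show ?thesis .
qed

lemma coeff_energy_nonneg:
  assumes "f holomorphic_on ball 0 R" "1 < R" "1 \<le> \<sigma>"
  shows "0 \<le> coeff_energy \<sigma> f"
  unfolding coeff_energy_def using assms
  by (intro suminf_nonneg coeff_energy_summable)
     (auto intro!: mult_nonneg_nonneg divide_nonneg_nonneg pochhammer_nonneg)

lemma coeff_energy_power_le:
  assumes f: "f holomorphic_on ball 0 R" and R: "1 < R" and \<sigma>: "1 \<le> \<sigma>" and "1 \<le> j"
  shows "coeff_energy (real j * \<sigma>) (\<lambda>z. f z ^ j) \<le> coeff_energy \<sigma> f ^ j"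
  using \<open>1 \<le> j\<close>
proof (induction j rule: nat_induct_at_least)
  case (Suc j)
  have j\<sigma>: "1 \<le> real j * \<sigma>" using Suc \<sigma> mult_mono[of 1 "real j" 1 \<sigma>] by simp
  have "coeff_energy (real (Suc j) * \<sigma>) (\<lambda>z. f z ^ Suc j) = coeff_energy (\<sigma> + real j * \<sigma>) (\<lambda>z. f z * f z ^ j)"
    by (simp add: algebra_simps)
  also have "\<dots> \<le> coeff_energy \<sigma> f * coeff_energy (real j * \<sigma>) (\<lambda>z. f z ^ j)"
    using f R \<sigma> j\<sigma> by (intro coeff_energy_mult_le) (auto intro!: holomorphic_intros)
  also have "\<dots> \<le> coeff_energy \<sigma> f * coeff_energy \<sigma> f ^ j"
    using Suc coeff_energy_nonneg[OF f R \<sigma>] by (intro mult_left_mono)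
  finally show ?case by simp
qed simp

section \<open>Green's formula for powers of the modulus\<close>

text \<open>
  The \<open>n\<close>-th weights on both sides agree: with \<open>W = n! / (\<sigma> (\<sigma> + 1) \<dots> (\<sigma> + n))\<close> the two integrals
  contribute \<open>n W\<close> and \<open>\<sigma> W\<close>, and \<open>(n + \<sigma>) W\<close> is the weight of \<open>coeff_energy\<close>.  Unlike the
  integral of \<open>(1 - t)\<^sup>\<sigma>\<^sup>-\<^sup>2 \<bar>g\<bar>\<^sup>2\<close>, this form is still meaningful at \<open>\<sigma> = 1\<close>.
\<close>

lemma coeff_energy_eq_disc_integrals:
  assumes g: "g holomorphic_on ball 0 R" and R: "1 < R" and \<sigma>: "1 \<le> \<sigma>"
  shows "coeff_energy \<sigma> g = 1 / \<sigma> * disc_integral \<sigma> (\<lambda>z. (cmod (deriv g z))\<^sup>2) +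
           \<sigma> * disc_integral (\<sigma> - 1) (\<lambda>z. (cmod (g z))\<^sup>2)"
proof -
  define b where "b = (\<lambda>n. (cmod (taylor_coeff g n))\<^sup>2)"
  have pos: "0 < pochhammer \<sigma> n" for n using \<sigma> by (intro pochhammer_pos) auto
  have pos2: "0 < pochhammer (\<sigma> + 2) n" for n using \<sigma> by (intro pochhammer_pos) auto
  have 1: "(\<lambda>n. b n * (\<sigma> * fact n / pochhammer \<sigma> (Suc n))) sums (\<sigma> * disc_integral (\<sigma> - 1) (\<lambda>z. (cmod (g z))\<^sup>2))"
    using bergman_Parseval[OF g R, of "\<sigma> - 1"] \<sigma>
    by (simp add: b_def pochhammer_rec add.commute)
  have "(\<lambda>n. b (Suc n) * (real (Suc n) * fact (Suc n) / pochhammer \<sigma> (Suc (Suc n)))) sums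
          (1 / \<sigma> * disc_integral \<sigma> (\<lambda>z. (cmod (deriv g z))\<^sup>2))"
  proof -
    have "deriv g holomorphic_on ball 0 R" using g by (intro holomorphic_deriv) auto
    from sums_mult[OF bergman_Parseval[OF this R, of \<sigma>], of "1 / (\<sigma> * (\<sigma> + 1))"] \<sigma>
    have "(\<lambda>n. 1 / (\<sigma> * (\<sigma> + 1)) * ((cmod (taylor_coeff (deriv g) n))\<^sup>2 * (fact n / pochhammer (\<sigma> + 2) n))) sums
         (1 / \<sigma> * disc_integral \<sigma> (\<lambda>z. (cmod (deriv g z))\<^sup>2))"
      by simp
    moreover have "1 / (\<sigma> * (\<sigma> + 1)) * ((cmod (taylor_coeff (deriv g) n))\<^sup>2 * (fact n / pochhammer (\<sigma> + 2) n)) =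
        b (Suc n) * (real (Suc n) * fact (Suc n) / pochhammer \<sigma> (Suc (Suc n)))" for n
    proof -
      have "pochhammer \<sigma> (Suc (Suc n)) = \<sigma> * ((\<sigma> + 1) * pochhammer (\<sigma> + 2) n)"
        using pochhammer_rec[of \<sigma> "Suc n"] pochhammer_rec[of "\<sigma> + 1" n] by (simp only: add.assoc one_add_one)
      moreover have "(cmod (taylor_coeff (deriv g) n))\<^sup>2 = b (Suc n) * (real (Suc n))\<^sup>2"
        by (simp add: taylor_coeff_deriv b_def norm_mult power_mult_distrib del: of_nat_Suc)
      ultimately show ?thesis using \<sigma> pos2[of n]
        by (simp add: power2_eq_square fact_Suc mult_ac del: of_nat_Suc pochhammer_Suc)
    qed
    ultimately show ?thesis by simp
  qed
  from sums_Suc[OF this] have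
    2: "(\<lambda>n. b n * (real n * fact n / pochhammer \<sigma> (Suc n))) sums (1 / \<sigma> * disc_integral \<sigma> (\<lambda>z. (cmod (deriv g z))\<^sup>2))"
    by simp
  have "b n * (real n * fact n / pochhammer \<sigma> (Suc n)) + b n * (\<sigma> * fact n / pochhammer \<sigma> (Suc n)) =
       b n * (fact n / pochhammer \<sigma> n)" for n
  proof -
    have "0 < \<sigma> + real n" using \<sigma> by simp
    then show ?thesis using pos[of n]
      by (simp add: pochhammer_Suc divide_simps) (simp add: algebra_simps)
  qed
  with sums_add[OF 2 1] show ?thesis
    by (simp add: coeff_energy_def b_def sums_iff)
qed

lemma set_integrable_disc:
  assumes \<beta>: "\<beta> > -1" and h: "continuous_on (cball 0 1) h"
  shows "set_integrable lborel (ball 0 1) (\<lambda>z::complex. (1 - (cmod z)\<^sup>2) powr \<beta> * (h z :: real))"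
proof -
  obtain K where K: "\<And>z. z \<in> cball 0 1 \<Longrightarrow> norm (h z) \<le> K"
    using compact_imp_bounded[OF compact_continuous_image[OF h compact_cball]] unfolding bounded_iff by blast
  have int: "integrable lborel (\<lambda>z::complex. indicator (ball 0 1) z * (1 - (cmod z)\<^sup>2) powr \<beta>)"
    using has_bochner_integral_disc_moment[OF \<beta>, of 0] by (simp add: has_bochner_integral_iff)
  have "continuous_on (ball 0 1) h" using h by (rule continuous_on_subset) auto
  then have meas: "(\<lambda>z. indicator (ball 0 1) z *\<^sub>R h z) \<in> borel_measurable borel"
    by (intro borel_measurable_continuous_on_indicator) auto
  have "integrable lborel (\<lambda>z. (indicator (ball 0 1) z * (1 - (cmod z)\<^sup>2) powr \<beta>) * (indicator (ball 0 1) z *\<^sub>R h z))"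
  proof (rule Bochner_Integration.integrable_bound)
    show "integrable lborel (\<lambda>z::complex. (indicator (ball 0 1) z * (1 - (cmod z)\<^sup>2) powr \<beta>) * K)"
      using int by simp
    show "AE z::complex in lborel. norm (indicator (ball 0 1) z * (1 - (cmod z)\<^sup>2) powr \<beta> * (indicator (ball 0 1) z *\<^sub>R h z))
        \<le> norm (indicator (ball 0 1) z * (1 - (cmod z)\<^sup>2) powr \<beta> * K)"
      using K by (auto intro!: AE_I2 mult_left_mono order_trans[OF _ abs_ge_self] split: split_indicator simp: abs_mult)
  qed (rule borel_measurable_times[OF borel_measurable_integrable[OF int]], use meas in simp)
  then show ?thesis
    unfolding set_integrable_def
    by (rule Bochner_Integration.integrable_cong[THEN iffD1, rotated 2]) (auto split: split_indicator)
qed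

lemma disc_integral_add:
  assumes "\<beta> > -1" "continuous_on (cball 0 1) h" "continuous_on (cball 0 1) k"
  shows "disc_integral \<beta> (\<lambda>z. h z + k z) = disc_integral \<beta> h + disc_integral \<beta> k"
  using set_integral_add(2)[OF set_integrable_disc[OF assms(1,2)] set_integrable_disc[OF assms(1,3)]]
  by (simp add: disc_integral_def distrib_left)

lemma disc_integral_cmult:
  "disc_integral \<beta> (\<lambda>z. c * h z) = c * disc_integral \<beta> h"
proof -
  have "(LINT z:ball 0 1|lborel. (1 - (cmod z)\<^sup>2) powr \<beta> * (c * h z)) = c * (LINT z:ball 0 1|lborel. (1 - (cmod z)\<^sup>2) powr \<beta> * h z)"
    by (simp add: mult.left_commute)
  then show ?thesis by (simp add: disc_integral_def)
qed

lemma disc_integral_mono: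
  assumes "\<beta> > -1" "continuous_on (cball 0 1) h" "continuous_on (cball 0 1) k"
    and "\<And>z. cmod z < 1 \<Longrightarrow> h z \<le> k z"
  shows "disc_integral \<beta> h \<le> disc_integral \<beta> k"
  using set_integral_mono[OF set_integrable_disc[OF assms(1,2)] set_integrable_disc[OF assms(1,3)]] assms(4)
  by (force simp: disc_integral_def intro!: divide_right_mono mult_left_mono)

lemma disc_integral_sum:
  assumes "\<beta> > -1" "\<And>i. i \<in> A \<Longrightarrow> continuous_on (cball 0 1) (h i)"
  shows "disc_integral \<beta> (\<lambda>z. \<Sum>i\<in>A. h i z) = (\<Sum>i\<in>A. disc_integral \<beta> (h i))"
  using assms(2)
proof (induction A rule: infinite_finite_induct)
  case (insert i A)
  then show ?case
    by (simp add: disc_integral_add[OF assms(1)] continuous_on_sum)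
qed (simp_all add: disc_integral_def)

lemma disc_integral_cong:
  assumes "\<And>z. cmod z < 1 \<Longrightarrow> h z = k z"
  shows "disc_integral \<beta> h = disc_integral \<beta> k"
  unfolding disc_integral_def
  by (intro arg_cong2[where f="(*)"] set_lebesgue_integral_cong) (auto simp: assms)

lemma continuous_on_holomorphic_cball:
  assumes "f holomorphic_on ball 0 R" "1 < R"
  shows "continuous_on (cball 0 1) f" "continuous_on (cball 0 1) (deriv f)"
proof -
  have "deriv f holomorphic_on ball 0 R" using assms by (intro holomorphic_deriv) auto
  with assms show "continuous_on (cball 0 1) f" "continuous_on (cball 0 1) (deriv f)"
    by (auto intro!: holomorphic_on_imp_continuous_on elim!: holomorphic_on_subset)
qed

lemma coeff_energy_power_eq_disc_integrals:
  assumes f: "f holomorphic_on ball 0 R" and R: "1 < R" and \<sigma>: "1 \<le> \<sigma>"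
  shows "coeff_energy \<sigma> (\<lambda>z. f z ^ Suc m) =
           1 / \<sigma> * ((real (Suc m))\<^sup>2 * disc_integral \<sigma> (\<lambda>z. ((cmod (f z))\<^sup>2) ^ m * (cmod (deriv f z))\<^sup>2)) +
           \<sigma> * disc_integral (\<sigma> - 1) (\<lambda>z. ((cmod (f z))\<^sup>2) ^ Suc m)"
proof -
  have "deriv (\<lambda>z. f z ^ Suc m) z = of_nat (Suc m) * f z ^ m * deriv f z" if "cmod z < 1" for z
  proof -
    have "f field_differentiable at z"
      using f R that by (intro holomorphic_on_imp_differentiable_at[of f "ball 0 R"]) auto
    then have "(f has_field_derivative deriv f z) (at z)"
      by (rule field_differentiable_derivI)
    from DERIV_power[OF this, of "Suc m"] show ?thesis
      by (intro DERIV_imp_deriv) (simp add: mult_ac)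
  qed
  then have "disc_integral \<sigma> (\<lambda>z. (cmod (deriv (\<lambda>z. f z ^ Suc m) z))\<^sup>2) =
      disc_integral \<sigma> (\<lambda>z. (real (Suc m))\<^sup>2 * (((cmod (f z))\<^sup>2) ^ m * (cmod (deriv f z))\<^sup>2))"
    by (intro disc_integral_cong)
       (simp add: norm_mult norm_power power_mult_distrib power_mult[symmetric] mult.commute del: of_nat_Suc)
  then show ?thesis
    using coeff_energy_eq_disc_integrals[of "\<lambda>z. f z ^ Suc m" R \<sigma>] f R \<sigma>
    by (simp add: disc_integral_cmult holomorphic_intros norm_power power_mult[symmetric] mult.commute
             del: power_Suc of_nat_Suc)
qed

text \<open>
  Green's formula for \<open>\<bar>f\<bar>\<^sup>2\<^sup>(\<^sup>m\<^sup>+\<^sup>1\<^sup>)\<close>.  Here \<open>\<sigma>\<close> is independent of \<open>m\<close>, so that the identities for different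
  \<open>m\<close> can be combined linearly.
\<close>

lemma disc_integral_power_identity:
  assumes f: "f holomorphic_on ball 0 R" and R: "1 < R" and \<sigma>: "1 < \<sigma>"
  shows "(\<sigma> - 1) * disc_integral (\<sigma> - 2) (\<lambda>z. ((cmod (f z))\<^sup>2) ^ Suc m) =
           1 / \<sigma> * ((real (Suc m))\<^sup>2 * disc_integral \<sigma> (\<lambda>z. ((cmod (f z))\<^sup>2) ^ m * (cmod (deriv f z))\<^sup>2)) +
           \<sigma> * disc_integral (\<sigma> - 1) (\<lambda>z. ((cmod (f z))\<^sup>2) ^ Suc m)"
proof -
  have "(\<lambda>z. f z ^ Suc m) holomorphic_on ball 0 R" using f by (intro holomorphic_intros)
  from bergman_Parseval[OF this R, of "\<sigma> - 2"] \<sigma>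
  have "coeff_energy \<sigma> (\<lambda>z. f z ^ Suc m) = (\<sigma> - 1) * disc_integral (\<sigma> - 2) (\<lambda>z. ((cmod (f z))\<^sup>2) ^ Suc m)"
    by (simp add: coeff_energy_def sums_iff norm_power power_mult[symmetric] mult.commute del: power_Suc)
  then show ?thesis
    using coeff_energy_power_eq_disc_integrals[OF f R, of \<sigma>] \<sigma> by simp
qed

text \<open>
  Green's formula turns \<open>P(\<bar>f\<bar>\<^sup>2)\<close> into \<open>(v P')'\<close> at \<open>v = \<bar>f\<bar>\<^sup>2\<close>, times \<open>\<bar>f'\<bar>\<^sup>2\<close>; for \<open>P = v\<^sup>x\<close> this is
  \<open>x\<^sup>2 v\<^sup>x\<^sup>-\<^sup>1\<close>.  So one approximates \<open>x\<^sup>2 v\<^sup>x\<^sup>-\<^sup>1\<close> by a polynomial \<open>\<Sum> q\<^sub>m v\<^sup>m\<close> and recovers \<open>P\<close> from it by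
  solving \<open>(v P')' = \<Sum> q\<^sub>m v\<^sup>m\<close>.  Two integrations carry the error bound over to \<open>P\<close>.
\<close>

lemma powr_polynomial_approximation:
  fixes x V \<delta> :: real
  assumes x: "1 < x" and V: "0 < V" and \<delta>: "0 < \<delta>"
  obtains q :: "nat \<Rightarrow> real" and M where
    "\<And>v. 0 \<le> v \<Longrightarrow> v \<le> V \<Longrightarrow> \<bar>x\<^sup>2 * v powr (x - 1) - (\<Sum>m\<le>M. q m * v ^ m)\<bar> \<le> \<delta>"
    "\<And>v. 0 \<le> v \<Longrightarrow> v \<le> V \<Longrightarrow> \<bar>v powr x - (\<Sum>m\<le>M. q m / (real (Suc m))\<^sup>2 * v ^ Suc m)\<bar> \<le> \<delta> * v"
proof -
  have "continuous_on {0..V} (\<lambda>v. x\<^sup>2 * v powr (x - 1))"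
    using x by (intro continuous_intros continuous_on_powr') auto
  from Stone_Weierstrass_real_polynomial_function[OF compact_Icc this \<delta>]
  obtain g where g: "real_polynomial_function g" "\<And>v. v \<in> {0..V} \<Longrightarrow> \<bar>x\<^sup>2 * v powr (x - 1) - g v\<bar> < \<delta>"
    by blast
  then obtain q M where q: "g = (\<lambda>v. \<Sum>m\<le>M. q m * v ^ m)"
    by (auto simp: real_polynomial_function_iff_sum)
  \<comment> \<open>\<open>D\<close> is the error of \<open>P\<close> and \<open>E\<close> is \<open>v D'\<close>; the derivative of \<open>E\<close> is the error of the polynomial with coefficients \<open>q\<close>.\<close>
  define E where "E = (\<lambda>v. x * v powr x - (\<Sum>m\<le>M. q m / real (Suc m) * v ^ Suc m))"
  define D where "D = (\<lambda>v. v powr x - (\<Sum>m\<le>M. q m / (real (Suc m))\<^sup>2 * v ^ Suc m))"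
  have dE: "(E has_real_derivative x\<^sup>2 * v powr (x - 1) - g v) (at v)" if "0 < v" for v
    unfolding E_def q using that
    by (auto intro!: derivative_eq_intros sum.cong simp: power2_eq_square simp del: of_nat_Suc power_Suc)
  define c where "c = (\<lambda>m. q m / (real (Suc m))\<^sup>2)"
  have Dc: "D = (\<lambda>v. v powr x - (\<Sum>m\<le>M. c m * v ^ Suc m))"
    by (simp only: D_def c_def)
  have dD: "(D has_real_derivative E v / v) (at v)" if "0 < v" for v
  proof -
    have *: "q m / real (Suc m) * v ^ Suc m / v = c m * (real (Suc m) * v ^ m)" for m
      using that by (simp add: c_def power2_eq_square del: of_nat_Suc)
    have "v powr (x - 1) = v powr x / v" using that by (simp add: powr_diff)
    then have "E v / v = x * v powr (x - 1) - (\<Sum>m\<le>M. c m * (real (Suc m) * v ^ m))"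
      unfolding E_def by (simp add: diff_divide_distrib sum_divide_distrib * del: power_Suc of_nat_Suc times_divide_eq_left)
    then show ?thesis
      unfolding Dc using that
      by (auto intro!: derivative_eq_intros sum.cong simp del: of_nat_Suc power_Suc)
  qed
  have contE: "continuous_on {0..v} E" and contD: "continuous_on {0..v} D" for v
    unfolding E_def D_def using x by (auto intro!: continuous_intros continuous_on_powr')
  have E: "\<bar>E v\<bar> \<le> \<delta> * v" if v: "0 < v" "v \<le> V" for v
  proof -
    obtain \<xi> where \<xi>: "0 < \<xi>" "\<xi> < v" "E v - E 0 = (x\<^sup>2 * \<xi> powr (x - 1) - g \<xi>) * (v - 0)"
      using mvt[OF v(1) contE, of "\<lambda>\<xi> h. (x\<^sup>2 * \<xi> powr (x - 1) - g \<xi>) * h"] dE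
      by (auto simp: has_field_derivative_def)
    have "E 0 = 0" using x by (simp add: E_def)
    then show ?thesis using \<xi> v g(2)[of \<xi>]
      by (auto simp: abs_mult intro!: mult_right_mono less_imp_le)
  qed
  have D: "\<bar>D v\<bar> \<le> \<delta> * v" if v: "0 \<le> v" "v \<le> V" for v
  proof (cases "v = 0")
    case True
    then show ?thesis using x by (simp add: D_def)
  next
    case False
    with v have v0: "0 < v" by simp
    obtain \<xi> where \<xi>: "0 < \<xi>" "\<xi> < v" "D v - D 0 = E \<xi> / \<xi> * (v - 0)"
      using mvt[OF v0 contD, of "\<lambda>\<xi> h. E \<xi> / \<xi> * h"] dD[unfolded has_field_derivative_def]
      by blast
    have "\<bar>E \<xi> / \<xi>\<bar> \<le> \<delta>" using E[of \<xi>] \<xi> v by (simp add: abs_divide pos_divide_le_eq)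
    from mult_right_mono[OF this, of v] have "\<bar>E \<xi> / \<xi> * v\<bar> \<le> \<delta> * v"
      using v0 by (simp only: abs_mult) simp
    moreover have "D 0 = 0" using x by (simp add: D_def)
    ultimately show ?thesis using \<xi>(3) by simp
  qed
  show thesis
  proof (rule that[of q M])
    show "\<bar>x\<^sup>2 * v powr (x - 1) - (\<Sum>m\<le>M. q m * v ^ m)\<bar> \<le> \<delta>" if "0 \<le> v" "v \<le> V" for v
      using g(2)[of v] that by (auto simp: q)
    show "\<bar>v powr x - (\<Sum>m\<le>M. q m / (real (Suc m))\<^sup>2 * v ^ Suc m)\<bar> \<le> \<delta> * v" if "0 \<le> v" "v \<le> V" for v
      using D[OF that] by (simp only: D_def)
  qed
qed

text \<open>
  Approximating \<open>v\<^sup>x\<close> within \<open>\<delta> v\<close> and \<open>x\<^sup>2 v\<^sup>x\<^sup>-\<^sup>1\<close> within \<open>\<delta>\<close> changes each integral by at most \<open>\<delta>\<close>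
  times a constant, so that Green's formula passes from polynomials in \<open>v\<close> to \<open>v\<^sup>x\<close>.
\<close>

lemma disc_integral_powr_le:
  assumes f: "f holomorphic_on ball 0 R" and R: "1 < R" and \<sigma>: "1 < \<sigma>" and x: "1 < x"
  defines "v \<equiv> \<lambda>z. (cmod (f z))\<^sup>2" and "d \<equiv> \<lambda>z. (cmod (deriv f z))\<^sup>2"
  shows "(\<sigma> - 1) * disc_integral (\<sigma> - 2) (\<lambda>z. v z powr x) \<le>
           1 / \<sigma> * (x\<^sup>2 * disc_integral \<sigma> (\<lambda>z. v z powr (x - 1) * d z)) +
           \<sigma> * disc_integral (\<sigma> - 1) (\<lambda>z. v z powr x)" (is "?L \<le> ?R")
proof -
  have cv [continuous_intros]: "continuous_on (cball 0 1) v" and cd [continuous_intros]: "continuous_on (cball 0 1) d"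
    unfolding v_def d_def using continuous_on_holomorphic_cball[OF f R] by (auto intro!: continuous_intros)
  have v0: "0 \<le> v z" and d0: "0 \<le> d z" for z by (auto simp: v_def d_def)
  have cp [continuous_intros]: "continuous_on (cball 0 1) (\<lambda>z. v z powr x)" "continuous_on (cball 0 1) (\<lambda>z. v z powr (x - 1))"
    using x v0 by (auto intro!: continuous_on_powr' cv)
  have "bounded (v ` cball 0 1)"
    using cv by (intro compact_imp_bounded compact_continuous_image compact_cball)
  then obtain V0 where V0: "\<And>z. z \<in> cball 0 1 \<Longrightarrow> norm (v z) \<le> V0"
    unfolding bounded_iff by blast
  have "v z \<le> V0" if "cmod z < 1" for z using V0[of z] v0[of z] that by simp
  then obtain V where V: "0 < V" "\<And>z. cmod z < 1 \<Longrightarrow> v z \<le> V"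
    by (metis less_max_iff_disj max.coboundedI1 zero_less_one)
  have \<beta>: "\<sigma> - 2 > -1" "\<sigma> - 1 > -1" "\<sigma> > -1" using \<sigma> by auto
  \<comment> \<open>\<open>\<delta> * K\<close> collects the errors of the three integrals.\<close>
  define K where "K = (\<sigma> - 1) * disc_integral (\<sigma> - 2) v + (1 / \<sigma> * disc_integral \<sigma> d + \<sigma> * disc_integral (\<sigma> - 1) v)"
  have approx: "?L \<le> ?R + \<delta> * K" if \<delta>: "0 < \<delta>" for \<delta>
  proof -
    obtain q M where Q: "\<And>u. 0 \<le> u \<Longrightarrow> u \<le> V \<Longrightarrow> \<bar>x\<^sup>2 * u powr (x - 1) - (\<Sum>m\<le>M. q m * u ^ m)\<bar> \<le> \<delta>"
      and P: "\<And>u. 0 \<le> u \<Longrightarrow> u \<le> V \<Longrightarrow> \<bar>u powr x - (\<Sum>m\<le>M. q m / (real (Suc m))\<^sup>2 * u ^ Suc m)\<bar> \<le> \<delta> * u"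
      using powr_polynomial_approximation[OF x V(1) \<delta>] by blast
    define PV where "PV = (\<lambda>z. \<Sum>m\<le>M. q m / (real (Suc m))\<^sup>2 * v z ^ Suc m)"
    define QV where "QV = (\<lambda>z. (\<Sum>m\<le>M. q m * (v z ^ m * d z)))"
    have [continuous_intros]: "continuous_on (cball 0 1) PV" "continuous_on (cball 0 1) QV"
      unfolding PV_def QV_def by (intro continuous_intros)+
    have DP: "disc_integral \<beta> PV = (\<Sum>m\<le>M. q m / (real (Suc m))\<^sup>2 * disc_integral \<beta> (\<lambda>z. v z ^ Suc m))" if "\<beta> > -1" for \<beta>
      unfolding PV_def using that
      by (subst disc_integral_sum)
         (auto intro!: continuous_intros simp: disc_integral_cmult
           simp del: power_Suc of_nat_Suc times_divide_eq_left times_divide_eq_right)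
    have DQ: "disc_integral \<sigma> QV = (\<Sum>m\<le>M. q m * disc_integral \<sigma> (\<lambda>z. v z ^ m * d z))"
      unfolding QV_def using \<beta>(3)
      by (subst disc_integral_sum) (auto intro!: continuous_intros simp: disc_integral_cmult)
    have poly: "(\<sigma> - 1) * disc_integral (\<sigma> - 2) PV = 1 / \<sigma> * disc_integral \<sigma> QV + \<sigma> * disc_integral (\<sigma> - 1) PV"
    proof -
      have "(\<sigma> - 1) * disc_integral (\<sigma> - 2) PV =
          (\<Sum>m\<le>M. q m / (real (Suc m))\<^sup>2 * ((\<sigma> - 1) * disc_integral (\<sigma> - 2) (\<lambda>z. v z ^ Suc m)))"
        by (simp add: DP[OF \<beta>(1)] sum_distrib_left mult_ac del: power_Suc of_nat_Suc)
      also have "\<dots> = (\<Sum>m\<le>M. 1 / \<sigma> * (q m * disc_integral \<sigma> (\<lambda>z. v z ^ m * d z)) +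
            \<sigma> * (q m / (real (Suc m))\<^sup>2 * disc_integral (\<sigma> - 1) (\<lambda>z. v z ^ Suc m)))"
        unfolding v_def d_def disc_integral_power_identity[OF f R \<sigma>]
        by (intro sum.cong refl) (simp add: distrib_left del: power_Suc of_nat_Suc)
      also have "\<dots> = 1 / \<sigma> * disc_integral \<sigma> QV + \<sigma> * disc_integral (\<sigma> - 1) PV"
        unfolding DP[OF \<beta>(2)] DQ by (simp add: sum.distrib sum_distrib_left)
      finally show ?thesis .
    qed
    have "disc_integral (\<sigma> - 2) (\<lambda>z. v z powr x) \<le> disc_integral (\<sigma> - 2) (\<lambda>z. PV z + \<delta> * v z)"
      using P[OF v0 V(2)] \<beta> by (intro disc_integral_mono) (auto intro!: continuous_intros simp: PV_def abs_le_iff algebra_simps)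
    also have "\<dots> = disc_integral (\<sigma> - 2) PV + \<delta> * disc_integral (\<sigma> - 2) v"
      using \<beta> by (subst disc_integral_add) (auto intro!: continuous_intros simp: disc_integral_cmult)
    finally have 1: "?L \<le> (\<sigma> - 1) * (disc_integral (\<sigma> - 2) PV + \<delta> * disc_integral (\<sigma> - 2) v)"
      using \<sigma> by (intro mult_left_mono) auto
    have "disc_integral (\<sigma> - 1) PV \<le> disc_integral (\<sigma> - 1) (\<lambda>z. v z powr x + \<delta> * v z)"
      using P[OF v0 V(2)] \<beta> by (intro disc_integral_mono) (auto intro!: continuous_intros simp: PV_def abs_le_iff algebra_simps)
    also have "\<dots> = disc_integral (\<sigma> - 1) (\<lambda>z. v z powr x) + \<delta> * disc_integral (\<sigma> - 1) v"
      using \<beta> by (subst disc_integral_add) (auto intro!: continuous_intros simp: disc_integral_cmult)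
    finally have 2: "\<sigma> * disc_integral (\<sigma> - 1) PV \<le> \<sigma> * (disc_integral (\<sigma> - 1) (\<lambda>z. v z powr x) + \<delta> * disc_integral (\<sigma> - 1) v)"
      using \<sigma> by (intro mult_left_mono) auto
    have "QV z \<le> x\<^sup>2 * (v z powr (x - 1) * d z) + \<delta> * d z" if "cmod z < 1" for z
    proof -
      have "(\<Sum>m\<le>M. q m * v z ^ m) \<le> x\<^sup>2 * v z powr (x - 1) + \<delta>"
        using Q[OF v0 V(2)[OF that]] by (auto simp: abs_le_iff)
      from mult_right_mono[OF this d0[of z]]
      have "QV z \<le> (x\<^sup>2 * v z powr (x - 1) + \<delta>) * d z"
        by (simp add: QV_def sum_distrib_right mult.assoc)
      then show ?thesis by (simp add: algebra_simps)
    qed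
    then have "disc_integral \<sigma> QV \<le> disc_integral \<sigma> (\<lambda>z. x\<^sup>2 * (v z powr (x - 1) * d z) + \<delta> * d z)"
      using \<beta> by (intro disc_integral_mono) (auto intro!: continuous_intros)
    also have "\<dots> = x\<^sup>2 * disc_integral \<sigma> (\<lambda>z. v z powr (x - 1) * d z) + \<delta> * disc_integral \<sigma> d"
      using \<beta> by (subst disc_integral_add) (auto intro!: continuous_intros simp: disc_integral_cmult)
    finally have 3: "1 / \<sigma> * disc_integral \<sigma> QV \<le> 1 / \<sigma> * (x\<^sup>2 * disc_integral \<sigma> (\<lambda>z. v z powr (x - 1) * d z) + \<delta> * disc_integral \<sigma> d)"
      using \<sigma> by (intro mult_left_mono) auto
    have "?L \<le> ((\<sigma> - 1) * disc_integral (\<sigma> - 2) PV) + \<delta> * ((\<sigma> - 1) * disc_integral (\<sigma> - 2) v)"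
      using 1 by (simp add: algebra_simps)
    also have "\<dots> \<le> ?R + \<delta> * K"
      unfolding poly K_def using 2 3 by (simp add: distrib_left mult.left_commute)
    finally show ?thesis .
  qed
  have K: "0 \<le> K"
  proof -
    have "0 \<le> disc_integral \<beta> h" if "\<And>z. 0 \<le> h z" for \<beta> h
      unfolding disc_integral_def set_lebesgue_integral_def using that
      by (intro mult_nonneg_nonneg Bochner_Integration.integral_nonneg) (auto split: split_indicator)
    then show ?thesis unfolding K_def using \<sigma> v0 d0
      by (intro add_nonneg_nonneg mult_nonneg_nonneg) auto
  qed
  show ?thesis
  proof (rule field_le_epsilon)
    fix e :: real assume "0 < e"
    then have "?L \<le> ?R + e / (K + 1) * K" using K by (intro approx) auto
    also have "e / (K + 1) * K \<le> e" using K \<open>0 < e\<close> by (simp add: field_simps)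
    finally show "?L \<le> ?R + e" by simp
  qed
qed

lemma disc_integral_le_combination:
  assumes "\<beta> > -1" "\<beta>\<^sub>1 > -1" "\<beta>\<^sub>2 > -1"
    and "continuous_on (cball 0 1) h" "continuous_on (cball 0 1) h\<^sub>1" "continuous_on (cball 0 1) h\<^sub>2"
    and le: "\<And>z. cmod z < 1 \<Longrightarrow> (1 - (cmod z)\<^sup>2) powr \<beta> * h z \<le>
          c\<^sub>1 * ((1 - (cmod z)\<^sup>2) powr \<beta>\<^sub>1 * h\<^sub>1 z) + c\<^sub>2 * ((1 - (cmod z)\<^sup>2) powr \<beta>\<^sub>2 * h\<^sub>2 z)"
  shows "disc_integral \<beta> h \<le> c\<^sub>1 * disc_integral \<beta>\<^sub>1 h\<^sub>1 + c\<^sub>2 * disc_integral \<beta>\<^sub>2 h\<^sub>2"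
proof -
  note int = set_integrable_disc[OF assms(1,4)] set_integrable_disc[OF assms(2,5)] set_integrable_disc[OF assms(3,6)]
  have "(LINT z:ball 0 1|lborel. (1 - (cmod z)\<^sup>2) powr \<beta> * h z) \<le>
     (LINT z:ball 0 1|lborel. c\<^sub>1 * ((1 - (cmod z)\<^sup>2) powr \<beta>\<^sub>1 * h\<^sub>1 z) + c\<^sub>2 * ((1 - (cmod z)\<^sup>2) powr \<beta>\<^sub>2 * h\<^sub>2 z))"
    using int le by (intro set_integral_mono set_integral_add set_integrable_mult_right) auto
  also have "\<dots> = c\<^sub>1 * (LINT z:ball 0 1|lborel. (1 - (cmod z)\<^sup>2) powr \<beta>\<^sub>1 * h\<^sub>1 z) +
      c\<^sub>2 * (LINT z:ball 0 1|lborel. (1 - (cmod z)\<^sup>2) powr \<beta>\<^sub>2 * h\<^sub>2 z)"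
    using int by (subst set_integral_add) (auto intro!: set_integrable_mult_right)
  finally show ?thesis
    by (simp add: disc_integral_def field_simps)
qed

section \<open>Interpolation between consecutive even exponents\<close>

text \<open>
  Since \<open>x = (k - x) (k - 1) + (x - (k - 1)) k\<close>, this is the quotient of a weighted arithmetic mean of
  \<open>k - 1\<close> and \<open>k\<close> by the geometric mean with the same weights.
\<close>

definition interpolation_constant :: "real \<Rightarrow> real \<Rightarrow> real" where
  "interpolation_constant k x = x / ((k - 1) powr (k - x) * k powr (x - (k - 1)))"

text \<open>
  Young's inequality for \<open>(k - 1) y\<^sup>k\<^sup>-\<^sup>2\<close> and \<open>k y\<^sup>k\<^sup>-\<^sup>1\<close> with weights \<open>k - x\<close> and \<open>x - (k - 1)\<close>: the factors
  \<open>k - 1\<close> and \<open>k\<close> are kept inside, because \<open>j y\<^sup>j\<close> is what Green's formula integrates for exponent \<open>j\<close>.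
\<close>

lemma mult_powr_le_interpolation:
  fixes x y :: real and k :: nat
  assumes k: "2 \<le> k" and x: "real k - 1 < x" "x \<le> real k" and y: "0 \<le> y"
  shows "x * y powr (x - 1) \<le> interpolation_constant k x *
           ((real k - x) * (real k - 1) * y ^ (k - 2) + (x - (real k - 1)) * real k * y ^ (k - 1))"
proof (cases "y = 0")
  case True
  then show ?thesis using k x
    by (auto simp: interpolation_constant_def intro!: mult_nonneg_nonneg add_nonneg_nonneg)
next
  case False
  with y have y: "0 < y" by simp
  define m where "m = (real k - 1) powr (real k - x) * real k powr (x - (real k - 1))"
  have m: "0 < m" using k by (auto simp: m_def)
  have pw: "y ^ (k - 2) = y powr (real k - 2)" "y ^ (k - 1) = y powr (real k - 1)"
    using y k by (simp_all add: powr_realpow[symmetric] of_nat_diff)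
  have "((real k - 1) * y powr (real k - 2)) powr (real k - x) * (real k * y powr (real k - 1)) powr (x - (real k - 1)) =
       m * (y powr ((real k - 2) * (real k - x)) * y powr ((real k - 1) * (x - (real k - 1))))"
    using k y by (simp add: m_def powr_mult powr_powr)
  also have "y powr ((real k - 2) * (real k - x)) * y powr ((real k - 1) * (x - (real k - 1))) = y powr (x - 1)"
    unfolding powr_add[symmetric] by (rule arg_cong[where f="(powr) y"]) algebra
  finally have "m * y powr (x - 1) \<le>
      (real k - x) * ((real k - 1) * y powr (real k - 2)) + (x - (real k - 1)) * (real k * y powr (real k - 1))"
    using Youngs_inequality_0[of "real k - x" "x - (real k - 1)" "(real k - 1) * y powr (real k - 2)" "real k * y powr (real k - 1)"]
      k x y by simp
  from mult_left_mono[OF this, of "x / m"] m x k show ?thesis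
    unfolding interpolation_constant_def m_def[symmetric] pw by (simp add: mult.assoc)
qed

text \<open>
  The pointwise inequality is applied to \<open>y = (1 - t)\<^sup>s \<bar>f\<bar>\<^sup>2 / T\<close>.  Integrated against the two densities of
  Green's formula, it bounds the expression for \<open>x\<close> by \<open>C T\<^sup>x\<close> times a convex combination of the
  expressions for \<open>j = k - 1\<close> and \<open>j = k\<close>, divided by \<open>T\<^sup>j\<close>.  The latter are at most 1 by
  \<open>coeff_energy_power_le\<close>.  Working with an upper bound \<open>T > 0\<close> instead of the energy itself avoids a
  division by zero for \<open>f = 0\<close>.
\<close>

lemma bergman_interpolation_bound:
  assumes f: "f holomorphic_on ball 0 R" and R: "1 < R"
    and s: "1 \<le> s" and k: "2 \<le> k" and x: "real k - 1 < x" "x \<le> real k"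
    and T: "0 < T" "coeff_energy s f \<le> T"
  shows "(x * s - 1) * disc_integral (x * s - 2) (\<lambda>z. (cmod (f z))\<^sup>2 powr x) \<le> interpolation_constant k x * T powr x"
proof -
  define v where "v = (\<lambda>z. (cmod (f z))\<^sup>2)"
  define d where "d = (\<lambda>z. (cmod (deriv f z))\<^sup>2)"
  define C where "C = interpolation_constant k x"
  define c\<^sub>1 where "c\<^sub>1 = C * T powr x * ((real k - x) * (real k - 1) / T ^ (k - 1))"
  define c\<^sub>2 where "c\<^sub>2 = C * T powr x * ((x - (real k - 1)) * real k / T ^ k)"
  have x1: "1 < x" using k x by linarith
  have \<sigma>: "1 < x * s" 
  proof -
    have "x * 1 \<le> x * s" using x1 s by (intro mult_left_mono) auto
    then show ?thesis using x1 by linarith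
  qed
  have C: "0 < C" using k x by (auto simp: C_def interpolation_constant_def)
  have k1: "real (k - 1) = real k - 1" "real (k - 2) = real k - 2" using k by (auto simp: of_nat_diff)
  have j\<sigma>: "1 \<le> real j * s" if "1 \<le> j" for j using that s mult_mono[of 1 "real j" 1 s] by simp
  have weights: "x * s > -1" "x * s - 1 > -1" "real k * s > -1" "real k * s - 1 > -1"
    "real (k - 1) * s > -1" "real (k - 1) * s - 1 > -1"
    using \<sigma> j\<sigma>[of k] j\<sigma>[of "k - 1"] k by linarith+
  have cv [continuous_intros]: "continuous_on (cball 0 1) v" and cd [continuous_intros]: "continuous_on (cball 0 1) d"
    unfolding v_def d_def using continuous_on_holomorphic_cball[OF f R] by (auto intro!: continuous_intros)
  have v0: "0 \<le> v z" and d0: "0 \<le> d z" for z by (auto simp: v_def d_def)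
  have cp [continuous_intros]: "continuous_on (cball 0 1) (\<lambda>z. v z powr x)" "continuous_on (cball 0 1) (\<lambda>z. v z powr (x - 1))"
    using x1 v0 by (auto intro!: continuous_on_powr' cv)

  have young: "x * (w powr (x * s) * u powr (x - 1)) \<le>
      (c\<^sub>1 * (w powr (real (k - 1) * s) * u ^ (k - 2)) + c\<^sub>2 * (w powr (real k * s) * u ^ (k - 1)))"
    if w: "0 < w" and u: "0 \<le> u" for w u
  proof -
    define y where "y = w powr s * u / T"
    have y: "0 \<le> y" using w u T by (auto simp: y_def)
    have yj: "w powr s * y ^ j = w powr (real (Suc j) * s) * u ^ j / T ^ j" for j
      using w by (simp add: y_def power_mult_distrib power_divide powr_realpow[symmetric] powr_powr powr_add[symmetric] algebra_simps)
    have yx: "w powr s * y powr (x - 1) = w powr (x * s) * u powr (x - 1) / T powr (x - 1)"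
      using w u T by (simp add: y_def powr_mult powr_divide powr_powr powr_add[symmetric] algebra_simps)
    have Tx: "T powr (x - 1) = T powr x / T" using T by (simp add: powr_diff)
    obtain i where i: "k = Suc (Suc i)" using k by (metis add_2_eq_Suc le_Suc_ex)
    have Tk: "T ^ k = T ^ (k - 1) * T" "T ^ (k - 1) = T ^ (k - 2) * T"
      by (simp_all add: i)
    have "x * (w powr (x * s) * u powr (x - 1)) = (x * y powr (x - 1)) * (w powr s * T powr (x - 1))"
      using yx T by (simp add: field_simps)
    also have "\<dots> \<le> (C * ((real k - x) * (real k - 1) * y ^ (k - 2) + (x - (real k - 1)) * real k * y ^ (k - 1))) * (w powr s * T powr (x - 1))"
      unfolding C_def using mult_powr_le_interpolation[OF k x y] by (rule mult_right_mono) auto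
    also have "\<dots> = C * T powr (x - 1) * ((real k - x) * (real k - 1) * (w powr s * y ^ (k - 2)) + (x - (real k - 1)) * real k * (w powr s * y ^ (k - 1)))"
      by (simp add: algebra_simps)
    also have "\<dots> = (c\<^sub>1 * (w powr (real (k - 1) * s) * u ^ (k - 2)) + c\<^sub>2 * (w powr (real k * s) * u ^ (k - 1)))"
    proof -
      have "Suc (k - 2) = k - 1" "Suc (k - 1) = k" using k by auto
      then show ?thesis unfolding yj Tx c\<^sub>1_def c\<^sub>2_def Tk using T
        by (simp add: distrib_left mult_ac del: One_nat_def)
    qed
    finally show ?thesis .
  qed

  \<comment> \<open>The right hand side of Green's formula for exponent \<open>j\<close> is the energy of \<open>f\<^sup>j\<close>.\<close>
  have N: "real j / s * disc_integral (real j * s) (\<lambda>z. v z ^ (j - 1) * d z) +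
        real j * s * disc_integral (real j * s - 1) (\<lambda>z. v z ^ j) \<le> T ^ j" if j: "1 \<le> j" for j
  proof -
    obtain m where m: "j = Suc m" using j by (cases j) auto
    have "real j / s * disc_integral (real j * s) (\<lambda>z. v z ^ (j - 1) * d z) +
        real j * s * disc_integral (real j * s - 1) (\<lambda>z. v z ^ j) = coeff_energy (real j * s) (\<lambda>z. f z ^ j)"
      using coeff_energy_power_eq_disc_integrals[OF f R j\<sigma>[OF j], of m] s
      by (simp add: m v_def d_def power2_eq_square del: power_Suc of_nat_Suc)
    also have "\<dots> \<le> coeff_energy s f ^ j" by (rule coeff_energy_power_le[OF f R s j])
    also have "\<dots> \<le> T ^ j" using T coeff_energy_nonneg[OF f R s] by (intro power_mono)
    finally show ?thesis .
  qed

  have A: "x * disc_integral (x * s) (\<lambda>z. v z powr (x - 1) * d z) \<le>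
     c\<^sub>1 * disc_integral (real (k - 1) * s) (\<lambda>z. v z ^ (k - 2) * d z) + c\<^sub>2 * disc_integral (real k * s) (\<lambda>z. v z ^ (k - 1) * d z)"
    unfolding disc_integral_cmult[of _ x, symmetric]
  proof (rule disc_integral_le_combination)
    fix z :: complex assume "cmod z < 1"
    then have "0 < 1 - (cmod z)\<^sup>2" by (simp add: abs_square_less_1)
    from mult_right_mono[OF young[OF this v0[of z]] d0[of z]]
    show "(1 - (cmod z)\<^sup>2) powr (x * s) * (x * (v z powr (x - 1) * d z)) \<le>
       c\<^sub>1 * ((1 - (cmod z)\<^sup>2) powr (real (k - 1) * s) * (v z ^ (k - 2) * d z)) +
       c\<^sub>2 * ((1 - (cmod z)\<^sup>2) powr (real k * s) * (v z ^ (k - 1) * d z))"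
      by (simp add: algebra_simps del: One_nat_def)
  qed (rule weights | intro continuous_intros)+
  have B: "x * disc_integral (x * s - 1) (\<lambda>z. v z powr x) \<le>
     c\<^sub>1 * disc_integral (real (k - 1) * s - 1) (\<lambda>z. v z ^ (k - 1)) + c\<^sub>2 * disc_integral (real k * s - 1) (\<lambda>z. v z ^ k)"
    unfolding disc_integral_cmult[of _ x, symmetric]
  proof (rule disc_integral_le_combination)
    fix z :: complex assume "cmod z < 1"
    then have w: "0 < 1 - (cmod z)\<^sup>2" by (simp add: abs_square_less_1)
    define w where "w = 1 - (cmod z)\<^sup>2"
    define u where "u = v z"
    have w0: "0 < w" and u0: "0 \<le> u" using w v0 by (simp_all add: w_def u_def)
    have wp: "w powr (a - 1) = w powr a / w" for a using w0 by (simp add: powr_diff)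
    have ux: "u powr x = u powr (x - 1) * u" using u0 by (cases "u = 0") (auto simp: powr_diff)
    obtain i where i: "k = Suc (Suc i)" using k by (metis add_2_eq_Suc le_Suc_ex)
    have uk: "u ^ k = u ^ (k - 1) * u" "u ^ (k - 1) = u ^ (k - 2) * u"
      by (simp_all add: i)
    have "w powr (x * s - 1) * (x * u powr x) = (x * (w powr (x * s) * u powr (x - 1))) * (u / w)"
      unfolding wp ux by simp
    also have "\<dots> \<le> (c\<^sub>1 * (w powr (real (k - 1) * s) * u ^ (k - 2)) + c\<^sub>2 * (w powr (real k * s) * u ^ (k - 1))) * (u / w)"
      using w0 u0 by (intro mult_right_mono young) auto
    also have "\<dots> = c\<^sub>1 * (w powr (real (k - 1) * s - 1) * u ^ (k - 1)) + c\<^sub>2 * (w powr (real k * s - 1) * u ^ k)"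
    proof -
      have "(c\<^sub>1 * (W\<^sub>1 * a) + c\<^sub>2 * (W\<^sub>2 * b)) * (u / w) = c\<^sub>1 * (W\<^sub>1 / w * (a * u)) + c\<^sub>2 * (W\<^sub>2 / w * (b * u))"
        for W\<^sub>1 W\<^sub>2 a b by (simp add: add_divide_distrib algebra_simps)
      then show ?thesis by (simp only: wp uk(1)) (simp only: uk(2))
    qed
    finally show "(1 - (cmod z)\<^sup>2) powr (x * s - 1) * (x * v z powr x) \<le>
       c\<^sub>1 * ((1 - (cmod z)\<^sup>2) powr (real (k - 1) * s - 1) * v z ^ (k - 1)) +
       c\<^sub>2 * ((1 - (cmod z)\<^sup>2) powr (real k * s - 1) * v z ^ k)"
      by (simp only: w_def u_def)
  qed (rule weights | intro continuous_intros)+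
  define A\<^sub>1 where "A\<^sub>1 = disc_integral (real (k - 1) * s) (\<lambda>z. v z ^ (k - 2) * d z)"
  define A\<^sub>2 where "A\<^sub>2 = disc_integral (real k * s) (\<lambda>z. v z ^ (k - 1) * d z)"
  define B\<^sub>1 where "B\<^sub>1 = disc_integral (real (k - 1) * s - 1) (\<lambda>z. v z ^ (k - 1))"
  define B\<^sub>2 where "B\<^sub>2 = disc_integral (real k * s - 1) (\<lambda>z. v z ^ k)"
  have N1: "(real k - 1) / s * A\<^sub>1 + (real k - 1) * s * B\<^sub>1 \<le> T ^ (k - 1)"
    using N[of "k - 1"] k unfolding A\<^sub>1_def B\<^sub>1_def k1(1)[symmetric] by (simp add: numeral_2_eq_2)
  have N2: "real k / s * A\<^sub>2 + real k * s * B\<^sub>2 \<le> T ^ k"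
    using N[of k] k unfolding A\<^sub>2_def B\<^sub>2_def by simp
  have cpos: "0 \<le> c\<^sub>1 / (real k - 1)" "0 \<le> c\<^sub>2 / real k"
    using C k x T by (auto simp: c\<^sub>1_def c\<^sub>2_def intro!: divide_nonneg_nonneg mult_nonneg_nonneg)
  have "(x * s - 1) * disc_integral (x * s - 2) (\<lambda>z. v z powr x) \<le>
      1 / (x * s) * (x\<^sup>2 * disc_integral (x * s) (\<lambda>z. v z powr (x - 1) * d z)) + x * s * disc_integral (x * s - 1) (\<lambda>z. v z powr x)"
    unfolding v_def d_def by (rule disc_integral_powr_le[OF f R \<sigma> x1])
  also have "\<dots> = 1 / s * (x * disc_integral (x * s) (\<lambda>z. v z powr (x - 1) * d z)) + s * (x * disc_integral (x * s - 1) (\<lambda>z. v z powr x))"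
    using x1 s by (simp add: power2_eq_square)
  also have "\<dots> \<le> 1 / s * (c\<^sub>1 * A\<^sub>1 + c\<^sub>2 * A\<^sub>2) + s * (c\<^sub>1 * B\<^sub>1 + c\<^sub>2 * B\<^sub>2)"
    using A B s unfolding A\<^sub>1_def A\<^sub>2_def B\<^sub>1_def B\<^sub>2_def by (intro add_mono mult_left_mono) auto
  also have "\<dots> = c\<^sub>1 / (real k - 1) * ((real k - 1) / s * A\<^sub>1 + (real k - 1) * s * B\<^sub>1) + c\<^sub>2 / real k * (real k / s * A\<^sub>2 + real k * s * B\<^sub>2)"
    using k s by (simp add: distrib_left add_divide_distrib)
  also have "\<dots> \<le> c\<^sub>1 / (real k - 1) * T ^ (k - 1) + c\<^sub>2 / real k * T ^ k"
    using N1 N2 cpos by (intro add_mono mult_left_mono)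
  also have "\<dots> = C * T powr x * (real k - x) + C * T powr x * (x - (real k - 1))"
    using k T by (simp add: c\<^sub>1_def c\<^sub>2_def del: One_nat_def)
  also have "\<dots> = C * T powr x" by (simp add: algebra_simps)
  finally show ?thesis by (simp add: v_def C_def)
qed

section \<open>Approximation by dilates\<close>

text \<open>
  Fatou's lemma for Bochner integrals of real functions.
\<close>

lemma integral_le_of_pointwise_limit:
  fixes u :: "nat \<Rightarrow> 'a \<Rightarrow> real"
  assumes u: "\<And>n. integrable M (u n)" "\<And>n x. 0 \<le> u n x" and K: "\<And>n. integral\<^sup>L M (u n) \<le> K"
    and lim: "\<And>x. (\<lambda>n. u n x) \<longlonglongrightarrow> g x"
  shows "integrable M g" "integral\<^sup>L M g \<le> K"
proof -
  have [measurable]: "u n \<in> borel_measurable M" for n using u(1) by auto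
  have [measurable]: "g \<in> borel_measurable M"
    by (rule borel_measurable_LIMSEQ_real[OF lim]) measurable
  have g0: "0 \<le> g x" for x
    using lim u(2) by (intro LIMSEQ_le_const[OF lim]) auto
  have K0: "0 \<le> K" using K[of 0] u by (meson Bochner_Integration.integral_nonneg order_trans)
  have "(\<integral>\<^sup>+x. ennreal (g x) \<partial>M) = (\<integral>\<^sup>+x. liminf (\<lambda>n. ennreal (u n x)) \<partial>M)"
  proof (intro nn_integral_cong)
    fix x
    have "(\<lambda>n. ennreal (u n x)) \<longlonglongrightarrow> ennreal (g x)" using lim by (rule tendsto_ennrealI)
    then show "ennreal (g x) = liminf (\<lambda>n. ennreal (u n x))"
      by (simp add: lim_imp_Liminf)
  qed
  also have "\<dots> \<le> liminf (\<lambda>n. \<integral>\<^sup>+x. ennreal (u n x) \<partial>M)"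
    by (rule nn_integral_liminf) measurable
  also have "\<dots> \<le> liminf (\<lambda>n. ennreal K)"
    by (rule Liminf_mono) (use K u in \<open>auto simp: nn_integral_eq_integral intro!: always_eventually ennreal_leI\<close>)
  also have "\<dots> = ennreal K" by (simp add: Liminf_const)
  finally have le: "(\<integral>\<^sup>+x. ennreal (g x) \<partial>M) \<le> ennreal K" .
  show int: "integrable M g"
    using g0 le by (intro integrableI_nonneg) (auto simp: top_unique less_top[symmetric])
  have "ennreal (integral\<^sup>L M g) \<le> ennreal K"
    using le g0 int by (simp add: nn_integral_eq_integral)
  then show "integral\<^sup>L M g \<le> K" using K0 by simp
qed

lemma power2_powr: "0 \<le> c \<Longrightarrow> (c\<^sup>2) powr x = c powr (2 * x)" for c x :: real
  by (cases "c = 0") (simp_all add: powr_powr powr_numeral[symmetric] del: powr_numeral)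

lemma holomorphic_dilate:
  assumes f: "f holomorphic_on ball 0 1" and r: "0 < r" "r < 1"
  shows "(\<lambda>z. f (of_real r * z)) holomorphic_on ball 0 (1 / r)"
proof -
  have "f \<circ> (\<lambda>z. of_real r * z) holomorphic_on ball 0 (1 / r)"
    using r f by (intro holomorphic_on_compose_gen[OF _ f] holomorphic_intros)
      (auto simp: norm_mult field_simps)
  then show ?thesis by (simp add: o_def)
qed

lemma circle_orthogonal:
  assumes "n \<noteq> m"
  shows "(LINT t|lborel. complex_of_real (indicator {0..2 * pi} t) *
      ((of_real r * cis t) ^ n * cnj ((of_real r * cis t) ^ m))) = 0"
proof -
  define k where "k = real n - real m"
  have k: "k \<noteq> 0" using assms by (simp add: k_def)
  define F where "F = (\<lambda>t. cis (k * t) / (\<i> * of_real k))"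
  have "(LINT t|lborel. indicator {0..2 * pi} t *\<^sub>R cis (k * t)) = F (2 * pi) - F 0"
  proof (rule integral_FTC_Icc)
    show "(F has_vector_derivative cis (k * t)) (at t within {0..2 * pi})" for t
      unfolding F_def cis_conv_exp using k
      by (auto intro!: derivative_eq_intros has_vector_derivative_real_field simp: field_simps)
    show "continuous_on {0..2 * pi} (\<lambda>t. cis (k * t))"
      by (intro continuous_intros)
  qed simp
  also have "\<dots> = 0"
  proof -
    have "cis (k * (2 * pi)) = 1"
      by (simp add: k_def left_diff_distrib cis_divide[symmetric] mult.commute[of _ "2 * pi"] cis_multiple_2pi)
    then show ?thesis by (simp add: F_def)
  qed
  finally have 0: "(LINT t|lborel. indicator {0..2 * pi} t *\<^sub>R cis (k * t)) = 0" .
  have eq: "complex_of_real (indicator {0..2 * pi} t) * ((of_real r * cis t) ^ n * cnj ((of_real r * cis t) ^ m)) =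
      of_real (r ^ (n + m)) * (indicator {0..2 * pi} t *\<^sub>R cis (k * t))" for t
  proof -
    have "cis (k * t) = cis (real n * t) * cis (- (real m * t))"
      by (simp add: k_def cis_mult left_diff_distrib)
    then show ?thesis
      by (simp add: power_mult_distrib Complex.DeMoivre cis_cnj power_add scaleR_conv_of_real mult_ac)
  qed
  show ?thesis unfolding eq by (simp only: integral_mult_right_zero 0 mult_zero_right)
qed

text \<open>
  Parseval's identity on the circle of radius \<open>r\<close>.
\<close>

lemma hardy_mean_2:
  assumes f: "f holomorphic_on ball 0 1" and r: "0 < r" "r < 1"
  shows "(hardy_mean 2 f r)\<^sup>2 = coeff_energy 1 (\<lambda>z. f (of_real r * z))"
proof -
  have rt: "cmod (of_real r * cis t) < 1" for t using r by (simp add: norm_mult)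
  have sums: "(\<lambda>n. (cmod (taylor_coeff f n))\<^sup>2 * (LINT t|lborel. indicator {0..2 * pi} t * (cmod ((of_real r * cis t) ^ n))\<^sup>2)) sums
      (LINT t|lborel. indicator {0..2 * pi} t * (cmod (f (of_real r * cis t)))\<^sup>2)"
  proof (rule orthogonal_series_sums(2)[where B="\<lambda>n. r ^ n"])
    have "continuous_on UNIV (\<lambda>t. (of_real r * cis t) ^ n)" for n
      by (intro continuous_intros)
    then show "(\<lambda>t. (of_real r * cis t) ^ n) \<in> borel_measurable lborel" for n
      by (simp add: borel_measurable_continuous_onI)
    show "summable (\<lambda>n. cmod (taylor_coeff f n) * r ^ n)"
      using summable_taylor_coeff[OF f] r by simp
    show "(\<lambda>n. taylor_coeff f n * (of_real r * cis t) ^ n) sums f (of_real r * cis t)" for t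
      by (rule taylor_coeff_sums[OF f rt])
  qed (use r circle_orthogonal in \<open>auto simp: norm_power norm_mult\<close>)
  have moment: "(LINT t|lborel. indicator {0..2 * pi} t * (cmod ((of_real r * cis t) ^ n))\<^sup>2) = 2 * pi * (r ^ n)\<^sup>2" for n
    using r by (simp add: norm_power norm_mult)
  have cont: "continuous_on {0..2 * pi} (\<lambda>t. cmod (f (of_real r * cis t)) powr 2)"
  proof -
    have "continuous_on {0..2 * pi} (\<lambda>t. f (of_real r * cis t))"
      by (rule continuous_on_compose2[OF holomorphic_on_imp_continuous_on[OF f]])
         (use rt in \<open>auto intro!: continuous_intros\<close>)
    then show ?thesis by (auto intro!: continuous_intros)
  qed
  have "integral {0..2 * pi} (\<lambda>t. cmod (f (of_real r * cis t)) powr 2) =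
     (LINT t|lborel. indicator {0..2 * pi} t * (cmod (f (of_real r * cis t)))\<^sup>2)"
    using set_borel_integral_eq_integral(2)[OF borel_integrable_atLeastAtMost'[OF cont]]
    by (simp add: set_lebesgue_integral_def)
  moreover have "1 / (2 * pi) * (LINT t|lborel. indicator {0..2 * pi} t * (cmod (f (of_real r * cis t)))\<^sup>2) =
      coeff_energy 1 (\<lambda>z. f (of_real r * z))"
  proof -
    have "(cmod (taylor_coeff (\<lambda>z. f (of_real r * z)) n))\<^sup>2 * (fact n / pochhammer 1 n) =
        (cmod (taylor_coeff f n))\<^sup>2 * (2 * pi * (r ^ n)\<^sup>2) / (2 * pi)" for n
      using r by (simp add: taylor_coeff_dilate[OF f r] norm_mult norm_power power_mult_distrib
          pochhammer_fact[symmetric])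
    then show ?thesis
      using sums_divide[OF sums, of "2 * pi"] by (simp add: coeff_energy_def moment sums_iff)
  qed
  ultimately have "hardy_mean 2 f r = coeff_energy 1 (\<lambda>z. f (of_real r * z)) powr (1 / 2)"
    by (simp add: hardy_mean_def)
  moreover have "0 \<le> coeff_energy 1 (\<lambda>z. f (of_real r * z))"
    using coeff_energy_nonneg[OF holomorphic_dilate[OF f r]] r by simp
  ultimately show ?thesis by (simp add: powr_half_sqrt)
qed

text \<open>
  The coefficients of the dilate are \<open>r\<^sup>n a\<^sub>n\<close>.  For the Hardy space the left hand side is the squared mean
  over a circle; for the Bergman spaces the factors \<open>r\<^sup>n\<close> are dropped and Bessel's inequality applies.
\<close>

lemma coeff_energy_dilate_le:
  assumes \<alpha>: "\<alpha> \<ge> -1" and f: "f \<in> A_space 2 \<alpha>" and r: "0 < r" "r < 1"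
  shows "coeff_energy (\<alpha> + 2) (\<lambda>z. f (of_real r * z)) \<le> (A_norm 2 \<alpha> f)\<^sup>2"
proof (cases "\<alpha> = -1")
  case True
  with f have hol: "f holomorphic_on ball 0 1" and bdd: "bdd_above (hardy_mean 2 f ` {0<..<1})"
    by (auto simp: A_space_def hardy_space_def)
  have "hardy_mean 2 f r \<le> hardy_norm 2 f"
    unfolding hardy_norm_def using bdd r by (intro cSUP_upper) auto
  then have "(hardy_mean 2 f r)\<^sup>2 \<le> (hardy_norm 2 f)\<^sup>2"
    by (intro power_mono) (auto simp: hardy_mean_def)
  then show ?thesis using True hardy_mean_2[OF hol r] by (simp add: A_norm_def)
next
  case False
  with \<alpha> have \<alpha>': "\<alpha> > -1" by simp
  from f False have hol: "f holomorphic_on ball 0 1"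
    and int: "set_integrable lborel (ball 0 1) (\<lambda>z. (1 - (cmod z)\<^sup>2) powr \<alpha> * (cmod (f z))\<^sup>2)"
    by (auto simp: A_space_def bergman_space_def)
  define E where "E = (\<alpha> + 1) * disc_integral \<alpha> (\<lambda>z. (cmod (f z))\<^sup>2)"
  have pos: "0 < pochhammer (\<alpha> + 2) n" for n using \<alpha>' by (intro pochhammer_pos) auto
  have E: "(\<Sum>n<N. (cmod (taylor_coeff f n))\<^sup>2 * (fact n / pochhammer (\<alpha> + 2) n)) \<le> E" for N
    unfolding E_def by (rule bergman_Bessel[OF hol \<alpha>' int])
  from E[of 0] have E0: "0 \<le> E" by simp
  have norm: "A_norm 2 \<alpha> f = E powr (1 / 2)"
    using False by (simp add: A_norm_def bergman_norm_def E_def disc_integral_def)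
  have "coeff_energy (\<alpha> + 2) (\<lambda>z. f (of_real r * z)) \<le> E"
    unfolding coeff_energy_def
  proof (rule suminf_le_const)
    show "summable (\<lambda>n. (cmod (taylor_coeff (\<lambda>z. f (of_real r * z)) n))\<^sup>2 * (fact n / pochhammer (\<alpha> + 2) n))"
      using coeff_energy_summable[OF holomorphic_dilate[OF hol r]] r \<alpha> by simp
    fix N
    have "(\<Sum>n<N. (cmod (taylor_coeff (\<lambda>z. f (of_real r * z)) n))\<^sup>2 * (fact n / pochhammer (\<alpha> + 2) n)) \<le>
        (\<Sum>n<N. (cmod (taylor_coeff f n))\<^sup>2 * (fact n / pochhammer (\<alpha> + 2) n))"
    proof (intro sum_mono mult_right_mono)
      fix n
      have "r ^ n \<le> 1" using r by (simp add: power_le_one)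
      then show "(cmod (taylor_coeff (\<lambda>z. f (of_real r * z)) n))\<^sup>2 \<le> (cmod (taylor_coeff f n))\<^sup>2"
        using r by (simp add: taylor_coeff_dilate[OF hol r] norm_mult norm_power mult_left_le_one_le)
      show "0 \<le> fact n / pochhammer (\<alpha> + 2) n" using pos[of n] by simp
    qed
    also note E
    finally show "(\<Sum>n<N. (cmod (taylor_coeff (\<lambda>z. f (of_real r * z)) n))\<^sup>2 * (fact n / pochhammer (\<alpha> + 2) n)) \<le> E" .
  qed
  then show ?thesis using E0 by (simp add: norm powr_half_sqrt)
qed

theorem corollary3p1:
  fixes \<alpha> p :: real and k :: nat and f :: "complex \<Rightarrow> complex"
  assumes "\<alpha> \<ge> -1"
    and "k \<ge> 2"
    and "2 * (real k - 1) < p" and "p \<le> 2 * real k"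
    and "f \<in> A_space 2 \<alpha>"
  shows "f \<in> A_space p (p / 2 * (\<alpha> + 2) - 2) \<and>
         A_norm p (p / 2 * (\<alpha> + 2) - 2) f
           \<le> (p / 2) powr (1 / p)
              * (1 / ((real k - 1) powr (real k / p - 1 / 2) * real k powr (1 / 2 - (real k - 1) / p)))
              * A_norm 2 \<alpha> f"
proof -
  define x where "x = p / 2"
  define s where "s = \<alpha> + 2"
  define N where "N = A_norm 2 \<alpha> f"
  define C where "C = interpolation_constant k x"
  have k: "2 \<le> k" and x: "real k - 1 < x" "x \<le> real k" and s: "1 \<le> s"
    using assms by (auto simp: x_def s_def)
  have x1: "1 < x" using k x by linarith
  have p: "p = 2 * x" by (simp add: x_def)
  have \<sigma>: "1 < x * s" 
  proof -
    have "x * 1 \<le> x * s" using x1 s by (intro mult_left_mono) auto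
    then show ?thesis using x1 by linarith
  qed
  have C: "0 < C" using k x by (auto simp: C_def interpolation_constant_def)
  have hol: "f holomorphic_on ball 0 1"
    using assms(5) by (auto simp: A_space_def hardy_space_def bergman_space_def split: if_splits)
  have N0: "0 \<le> N"
  proof (cases "\<alpha> = -1")
    case True
    have "0 \<le> hardy_mean 2 f (1 / 2)" by (simp add: hardy_mean_def)
    also have "\<dots> \<le> hardy_norm 2 f"
      unfolding hardy_norm_def using assms(5) True
      by (intro cSUP_upper) (auto simp: A_space_def hardy_space_def)
    finally show ?thesis using True by (simp add: N_def A_norm_def)
  qed (simp add: N_def A_norm_def bergman_norm_def)

  define g where "g = (\<lambda>z. indicator (ball 0 1) z * ((1 - (cmod z)\<^sup>2) powr (x * s - 2) * cmod (f z) powr p))"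
  define r where "r = (\<lambda>n::nat. 1 - 1 / (real n + 2))"
  have r: "0 < r n" "r n < 1" for n by (auto simp: r_def field_simps)
  have r_lim: "r \<longlonglongrightarrow> 1" unfolding r_def by real_asymp
  define h where "h = (\<lambda>n z. indicator (ball 0 1) z * ((1 - (cmod z)\<^sup>2) powr (x * s - 2) * (cmod (f (of_real (r n) * z)))\<^sup>2 powr x))"
  have lim: "(\<lambda>n. h n z) \<longlonglongrightarrow> g z" for z
  proof (cases "cmod z < 1")
    case True
    have "isCont f z"
      using hol True by (intro holomorphic_on_imp_continuous_on continuous_on_interior[where S="ball 0 1"]) auto
    moreover have "(\<lambda>n. of_real (r n) * z) \<longlonglongrightarrow> of_real 1 * z"
      by (intro tendsto_intros r_lim)
    ultimately have "(\<lambda>n. f (of_real (r n) * z)) \<longlonglongrightarrow> f z"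
      using isCont_tendsto_compose by fastforce
    then have "(\<lambda>n. (cmod (f (of_real (r n) * z)))\<^sup>2 powr x) \<longlonglongrightarrow> (cmod (f z))\<^sup>2 powr x"
      using x1 by (intro tendsto_powr' tendsto_intros) auto
    then show ?thesis
      unfolding h_def g_def p power2_powr[OF norm_ge_zero, symmetric]
      by (intro tendsto_mult tendsto_const)
  qed (simp add: h_def g_def)
  have hint: "integrable lborel (h n)" for n
  proof -
    have hol': "(\<lambda>z. f (of_real (r n) * z)) holomorphic_on ball 0 (1 / r n)"
      by (rule holomorphic_dilate[OF hol r])
    have "continuous_on (cball 0 1) (\<lambda>z. (cmod (f (of_real (r n) * z)))\<^sup>2 powr x)"
      using continuous_on_holomorphic_cball(1)[OF hol'] r[of n] x1
      by (auto intro!: continuous_intros continuous_on_powr')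
    from set_integrable_disc[OF _ this, of "x * s - 2"] \<sigma> show ?thesis
      by (simp add: set_integrable_def h_def)
  qed
  have hbound: "integral\<^sup>L lborel (h n) \<le> pi / (x * s - 1) * (C * T powr x)" if T: "N\<^sup>2 < T" for n T
  proof -
    have "coeff_energy s (\<lambda>z. f (of_real (r n) * z)) \<le> N\<^sup>2"
      unfolding s_def N_def by (rule coeff_energy_dilate_le[OF assms(1,5) r])
    then have "(x * s - 1) * disc_integral (x * s - 2) (\<lambda>z. (cmod (f (of_real (r n) * z)))\<^sup>2 powr x) \<le> C * T powr x"
      unfolding C_def using T r[of n] s k x
      by (intro bergman_interpolation_bound[OF holomorphic_dilate[OF hol r]]) (auto intro: le_less_trans[OF zero_le_power2])
    then show ?thesis using \<sigma>
      by (simp add: disc_integral_def set_lebesgue_integral_def h_def[symmetric] h_def field_simps)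
  qed
  have h0: "0 \<le> h n z" for n z by (simp add: h_def)
  have gint: "integrable lborel g"
    by (rule integral_le_of_pointwise_limit(1)[OF hint h0 hbound[of "N\<^sup>2 + 1"] lim]) simp
  have gT: "(x * s - 1) / pi * integral\<^sup>L lborel g \<le> C * T powr x" if "N\<^sup>2 < T" for T
  proof -
    have "integral\<^sup>L lborel g \<le> pi / (x * s - 1) * (C * T powr x)"
      by (rule integral_le_of_pointwise_limit(2)[OF hint h0 hbound[OF that] lim])
    then show ?thesis using \<sigma> by (simp add: field_simps)
  qed
  \<comment> \<open>\<open>T\<close> had to be positive, so \<open>N\<^sup>2\<close>, which may vanish, is reached as a limit from above.\<close>
  have "(\<lambda>n. C * (N\<^sup>2 + inverse (real (Suc n))) powr x) \<longlonglongrightarrow> C * (N\<^sup>2 + 0) powr x"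
    using x1 by (intro tendsto_intros tendsto_powr' LIMSEQ_inverse_real_of_nat) auto
  then have gN: "(x * s - 1) / pi * integral\<^sup>L lborel g \<le> C * (N\<^sup>2) powr x"
    using gT by (intro LIMSEQ_le_const) (auto intro!: exI[of _ 0])
  have neq: "x * s - 2 \<noteq> -1" using \<sigma> by simp
  have mem: "f \<in> A_space p (x * s - 2)"
    using hol gint neq by (simp add: A_space_def bergman_space_def set_integrable_def g_def)
  have g0: "0 \<le> integral\<^sup>L lborel g"
    by (intro Bochner_Integration.integral_nonneg) (simp add: g_def)
  have "A_norm p (x * s - 2) f = ((x * s - 1) / pi * integral\<^sup>L lborel g) powr (1 / p)"
    using neq by (simp add: A_norm_def bergman_norm_def set_lebesgue_integral_def g_def)
  also have "\<dots> \<le> (C * (N\<^sup>2) powr x) powr (1 / p)"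
    using gN g0 \<sigma> x1 by (intro powr_mono2) (auto simp: p)
  also have "\<dots> = C powr (1 / p) * N"
    using C N0 x1 by (simp add: powr_mult power2_powr powr_powr p)
  also have "C powr (1 / p) = (p / 2) powr (1 / p)
              * (1 / ((real k - 1) powr (real k / p - 1 / 2) * real k powr (1 / 2 - (real k - 1) / p)))"
  proof -
    have "(real k - x) * (1 / p) = real k / p - 1 / 2" "(x - (real k - 1)) * (1 / p) = 1 / 2 - (real k - 1) / p"
      using x1 by (simp_all add: p field_simps)
    then show ?thesis
      using k x1 by (simp add: C_def interpolation_constant_def powr_divide powr_mult powr_powr x_def[symmetric])
  qed
  finally show ?thesis using mem by (simp add: x_def s_def N_def)
qed

end
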